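(* Let $\nu$ be a Beurling weight and let $w \in W_{\nu}$ satisfy $w(z) \neq 0$ for all $z \in \mathcal{R}_{\nu}$ and $\mathrm{wind}(w,0) = 0$. Consider the complex measure $d\mu(z) = w(z)\,\frac{|dz|}{2\pi}$ on the unit circle $\Gamma$. Then there exists $n_0 = n_0(\nu)$ such that for every $n \geq n_0$ the monic orthogonal polynomial $\Phi_n$ of degree $n$ for $d\mu$ exists and is unique, and \[ \sum_{n \geq n_0} \nu_n\,|\Phi_n(0)| < \infty . \]
   Context: $\Gamma = \{z \in \mathbb{C} : |z| = 1\}$. For $\varphi \in L^1(\Gamma)$, $\varphi_k = \int_{-\pi}^{\pi} e^{-ik\theta}\varphi(e^{i\theta})\frac{d\theta}{2\pi}$ denotes the $k$-th Fourier coefficient. A Beurling weight is a sequence $\nu = (\nu_k)_{k \in \mathbb{Z}}$ with $\nu_j \geq 1$, $\nu_j = \nu_{-j}$ and $\nu_{j+k} \leq \nu_j \nu_k$ for all $j,k \in \mathbb{Z}$. The Beurling class is $W_{\nu} = \{\varphi \in L^1(\Gamma) : \sum_{j \in \mathbb{Z}} \nu_j |\varphi_j| < \infty\}$. Let $A(\nu) = \lim_{k\to\infty} \frac{\log \nu_k}{k}$ (this limit exists and is $\geq 0$), and $\mathcal{R}_{\nu} = \{z \in \mathbb{C} : e^{-A(\nu)} \leq |z| \leq e^{A(\nu)}\}$; every $\varphi \in W_\nu$ extends (via its Fourier series $\sum_j \varphi_j z^j$) to a function continuous on $\mathcal{R}_\nu$ and analytic in its interior, and "$w(z)\neq 0$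 on $\mathcal{R}_\nu$" refers to this extension. $\mathrm{wind}(w,0)$ is the winding number of $w|_\Gamma$ about $0$. For a (possibly complex) weight $w$, a monic orthogonal polynomial of degree $n$ is a polynomial $\Phi_n(z) = z^n + \dots$ satisfying $\int_\Gamma \Phi_n(z)\, z^{-k}\, w(z)\,|dz| = 0$ for $0 \leq k \leq n-1$.
   Formalization: The threshold n_0 may depend on w as well as on ν; a threshold depending on ν alone is impossible, since for w(z)=exp(i(j/2)(z^m+z^{-m})) with J_0(j)=0 the monic orthogonal polynomial of degree m does not exist, for any m. *)

theory Defs
  imports "HOL-Complex_Analysis.Complex_Analysis" "HOL-Computational_Algebra.Polynomial"
begin

definition in_L1_circle :: "(complex \<Rightarrow> complex) \<Rightarrow> bool" where
  "in_L1_circle \<phi> \<longleftrightarrow> (\<lambda>\<theta>. \<phi> (cis \<theta>)) absolutely_integrable_on {-pi..pi}"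

definition fourier_coeff :: "(complex \<Rightarrow> complex) \<Rightarrow> int \<Rightarrow> complex" where
  "fourier_coeff \<phi> k =
     integral {-pi..pi} (\<lambda>\<theta>. cis (- (of_int k * \<theta>)) * \<phi> (cis \<theta>)) / complex_of_real (2 * pi)"

definition beurling_weight :: "(int \<Rightarrow> real) \<Rightarrow> bool" where
  "beurling_weight \<nu> \<longleftrightarrow>
     (\<forall>j. \<nu> j \<ge> 1) \<and> (\<forall>j. \<nu> j = \<nu> (- j)) \<and> (\<forall>j k. \<nu> (j + k) \<le> \<nu> j * \<nu> k)"

definition beurling_class :: "(int \<Rightarrow> real) \<Rightarrow> (complex \<Rightarrow> complex) set" where
  "beurling_class \<nu> =
     {\<phi>. in_L1_circle \<phi> \<and> (\<lambda>j. \<nu> j * norm (fourier_coeff \<phi> j)) summable_on UNIV}"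

definition beurling_A :: "(int \<Rightarrow> real) \<Rightarrow> real" where
  "beurling_A \<nu> = lim (\<lambda>k::nat. ln (\<nu> (int k)) / real k)"

definition beurling_annulus :: "(int \<Rightarrow> real) \<Rightarrow> complex set" where
  "beurling_annulus \<nu> = {z. exp (- beurling_A \<nu>) \<le> norm z \<and> norm z \<le> exp (beurling_A \<nu>)}"

definition fourier_ext :: "(complex \<Rightarrow> complex) \<Rightarrow> complex \<Rightarrow> complex" where
  "fourier_ext \<phi> z = (\<Sum>\<^sub>\<infinity>j\<in>UNIV. fourier_coeff \<phi> j * z powi j)"

text \<open>Winding number of (the continuous representative of) w restricted to the circle, about 0.\<close>
definition wind0 :: "(complex \<Rightarrow> complex) \<Rightarrow> complex" where
  "wind0 \<phi> = winding_number (\<lambda>t. fourier_ext \<phi> (cis (2 * pi * t))) 0"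

definition monic_OP :: "(complex \<Rightarrow> complex) \<Rightarrow> nat \<Rightarrow> complex poly \<Rightarrow> bool" where
  "monic_OP w n p \<longleftrightarrow> degree p = n \<and> lead_coeff p = 1 \<and>
     (\<forall>k<n. integral {-pi..pi}
        (\<lambda>\<theta>. poly p (cis \<theta>) * cis (- (real k * \<theta>)) * w (cis \<theta>)) = 0)"

end

theory Submission
  imports Defs "HOL-Computational_Algebra.Fundamental_Theorem_Algebra"
begin

text \<open>A Wiener--Levy theorem for the Beurling algebra gives \<open>w = z\<^sup>m exp L\<close> with \<open>L\<close> in the algebra,
  and \<open>m = 0\<close> because the winding number vanishes. Splitting \<open>L\<close> into its nonnegative and negative
  frequencies gives a Wiener--Hopf factorization \<open>w = w\<^sub>+ w\<^sub>-\<close> with all factors and their inverses in the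
  algebra. In terms of \<open>w\<^sub>+ / w\<^sub>-\<close> and \<open>w\<^sub>- / w\<^sub>+\<close> the orthogonality relations become a
  linear system whose kernel consists of tails of the coefficients of these two functions and hence
  is contractive for large \<open>n\<close>; the norm is chosen so that all \<open>n\<close> are treated simultaneously, which
  yields the weighted summability directly.\<close>

section \<open>Weighted Wiener algebras\<close>

text \<open>A logarithm is sought rather than an inverse of \<open>w\<close> because it splits
  additively by frequency, and the exponentials of the two halves keep their half-line supports. The
  obstacle in finding it is that the weighted norm is not controlled by the supremum on the annulus:
  for a Laurent polynomial \<open>p\<close> close to \<open>f\<close>, the quotient
  \<open>(f - p) / p\<close> may still have large norm. Only its powers are geometrically small, up
  to a constant factor, and the logarithmic series asks for no more.

  The second obstacle is the sum over \<open>n\<close>. Treated one \<open>n\<close> at a time, the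
  contraction bounds \<open>\<nu> n * |\<Phi>\<^sub>n(0)|\<close> by a tail of a convergent series,
  and such tails need not be summable in \<open>n\<close>. The inhomogeneous term
  \<open>k (n + l)\<close>, however, is summable in \<open>n\<close> with the weight
  \<open>\<nu> (n + l)\<close>, uniformly in \<open>l\<close>. This dictates the order: the sum over
  \<open>n\<close> inside, the supremum over \<open>l\<close> outside. Both kernels have weighted
  tails at most \<open>1 / 2\<close>, so the iterated term gains the factor
  \<open>1 / 4\<close>.\<close>

definition annulus :: "real \<Rightarrow> complex set" where
  "annulus A = {z. exp (- A) \<le> norm z \<and> norm z \<le> exp A}"

lemma annulus_nonzero: "z \<in> annulus A \<Longrightarrow> z \<noteq> 0"
  by (auto simp: annulus_def)

lemma norm_powi_le_exp:
  assumes "z \<in> annulus A"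
  shows "norm (z powi j) \<le> exp (A * \<bar>real_of_int j\<bar>)"
proof -
  define r where "r = norm z"
  have r: "r > 0" using annulus_nonzero[OF assms] by (simp add: r_def)
  have "exp (-A) \<le> exp (ln r)" "exp (ln r) \<le> exp A"
    using assms r by (auto simp: annulus_def r_def)
  then have "\<bar>ln r\<bar> \<le> A" by simp
  have "norm (z powi j) = r powi j" by (simp add: norm_power_int r_def)
  also have "\<dots> = exp (real_of_int j * ln r)"
    using r by (simp add: powr_real_of_int'[symmetric] powr_def)
  also have "real_of_int j * ln r \<le> \<bar>real_of_int j\<bar> * \<bar>ln r\<bar>"
    by (metis abs_ge_self abs_mult)
  also have "\<dots> \<le> \<bar>real_of_int j\<bar> * A" using \<open>\<bar>ln r\<bar> \<le> A\<close> by (intro mult_left_mono) auto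
  finally show ?thesis by (simp add: mult.commute)
qed

lemma has_sum_single:
  fixes x :: "'a :: {topological_comm_monoid_add, t2_space}"
  shows "((\<lambda>j. if j = i then x else 0) has_sum x) UNIV"
  by (rule has_sum_finite_neutralI[of "{i}"]) auto

text \<open>\<open>A\<close> is a separate parameter because two instances are used side by side:
  the given weight with its growth rate, and a pure exponential weight on a slightly larger
  annulus.\<close>

locale wiener_weight =
  fixes \<nu> :: "int \<Rightarrow> real" and A :: real
  assumes beurling: "beurling_weight \<nu>"
    and A_nonneg: "0 \<le> A"
    and exp_A_le: "exp (A * \<bar>real_of_int j\<bar>) \<le> \<nu> j"
begin

lemma weight_ge_1: "1 \<le> \<nu> j" and weight_minus: "\<nu> (- j) = \<nu> j"
  and weight_add: "\<nu> (j + k) \<le> \<nu> j * \<nu> k"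
  using beurling by (auto simp: beurling_weight_def)

lemma weight_nonneg [simp]: "0 \<le> \<nu> j"
  using weight_ge_1[of j] by linarith

lemma weight_pos [simp]: "0 < \<nu> j"
  using weight_ge_1[of j] by linarith

lemma norm_powi_le: "z \<in> annulus A \<Longrightarrow> norm (z powi j) \<le> \<nu> j"
  using norm_powi_le_exp exp_A_le order_trans by blast

lemma one_in_annulus: "norm z = 1 \<Longrightarrow> z \<in> annulus A"
  using A_nonneg by (auto simp: annulus_def)

definition wnorm :: "(int \<Rightarrow> complex) \<Rightarrow> real" where
  "wnorm a = (\<Sum>\<^sub>\<infinity>j. \<nu> j * norm (a j))"

text \<open>The coefficients are explicit data and \<open>f\<close> matters only on the annulus, so
  identities checked pointwise there pass to the coefficients once uniqueness is known.\<close>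

definition wser :: "(complex \<Rightarrow> complex) \<Rightarrow> (int \<Rightarrow> complex) \<Rightarrow> bool" where
  "wser f a \<longleftrightarrow> (\<lambda>j. \<nu> j * norm (a j)) summable_on UNIV \<and>
     (\<forall>z\<in>annulus A. ((\<lambda>j. a j * z powi j) has_sum f z) UNIV)"

text \<open>\<open>S\<close> is meant for half-lines, which are closed under addition, so that
  products, powers and exponentials keep the support. \<open>B\<close> is a bound and not the norm
  itself, so that infinite series can be summed by comparison.\<close>

definition wbd :: "int set \<Rightarrow> (complex \<Rightarrow> complex) \<Rightarrow> real \<Rightarrow> bool" where
  "wbd S f B \<longleftrightarrow> (\<exists>a. wser f a \<and> (\<forall>j. j \<notin> S \<longrightarrow> a j = 0) \<and> wnorm a \<le> B)"

lemma wser_summable: "wser f a \<Longrightarrow> (\<lambda>j. \<nu> j * norm (a j)) summable_on UNIV"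
  and wser_has_sum: "wser f a \<Longrightarrow> z \<in> annulus A \<Longrightarrow> ((\<lambda>j. a j * z powi j) has_sum f z) UNIV"
  by (auto simp: wser_def)

lemma wser_cong:
  assumes "wser f a" "\<And>z. z \<in> annulus A \<Longrightarrow> f z = g z"
  shows "wser g a"
  using assms by (auto simp: wser_def)

lemma wbd_cong:
  assumes "wbd S f B" "\<And>z. z \<in> annulus A \<Longrightarrow> f z = g z"
  shows "wbd S g B"
  using assms wser_cong unfolding wbd_def by blast

lemma wbd_mono:
  assumes "wbd S f B" "S \<subseteq> T" "B \<le> C"
  shows "wbd T f C"
  using assms unfolding wbd_def by (meson order_trans subsetD)

lemma wnorm_nonneg: "0 \<le> wnorm a"
  unfolding wnorm_def by (intro infsum_nonneg) auto

lemma wbd_nonneg: "wbd S f B \<Longrightarrow> 0 \<le> B"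
  unfolding wbd_def using wnorm_nonneg order_trans by blast

lemma wser_norm_le:
  assumes "wser f a" "z \<in> annulus A"
  shows "norm (f z) \<le> wnorm a"
proof -
  have "norm (\<Sum>\<^sub>\<infinity>j. a j * z powi j) \<le> wnorm a"
    unfolding wnorm_def
  proof (rule norm_infsum_le)
    show "((\<lambda>j. a j * z powi j) has_sum (\<Sum>\<^sub>\<infinity>j. a j * z powi j)) UNIV"
      using wser_has_sum[OF assms] by (simp add: has_sum_iff)
    show "((\<lambda>j. \<nu> j * norm (a j)) has_sum (\<Sum>\<^sub>\<infinity>j. \<nu> j * norm (a j))) UNIV"
      using wser_summable[OF assms(1)] by simp
    fix j show "norm (a j * z powi j) \<le> \<nu> j * norm (a j)"
      using mult_right_mono[OF norm_powi_le[OF assms(2), of j], of "norm (a j)"]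
      by (simp add: norm_mult mult.commute)
  qed
  then show ?thesis using wser_has_sum[OF assms] by (simp add: has_sum_iff)
qed

lemma wbd_norm_le: "wbd S f B \<Longrightarrow> z \<in> annulus A \<Longrightarrow> norm (f z) \<le> B"
  unfolding wbd_def using wser_norm_le order_trans by blast

lemma wser_cmult:
  assumes "wser f a"
  shows "wser (\<lambda>z. c * f z) (\<lambda>j. c * a j)" "wnorm (\<lambda>j. c * a j) = norm c * wnorm a"
proof -
  have eq: "\<nu> j * norm (c * a j) = norm c * (\<nu> j * norm (a j))" for j
    by (simp add: norm_mult)
  show "wnorm (\<lambda>j. c * a j) = norm c * wnorm a"
    unfolding wnorm_def eq by (rule infsum_cmult_right')
  show "wser (\<lambda>z. c * f z) (\<lambda>j. c * a j)"
    unfolding wser_def eq mult.assoc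
    using assms by (auto simp: wser_def intro!: summable_on_cmult_right has_sum_cmult_right)
qed

lemma wser_add:
  assumes "wser f a" "wser g b"
  shows "wser (\<lambda>z. f z + g z) (\<lambda>j. a j + b j)" 
proof -
  have "(\<lambda>j. \<nu> j * norm (a j + b j)) summable_on UNIV"
  proof (rule summable_on_comparison_test)
    show "(\<lambda>j. \<nu> j * norm (a j) + \<nu> j * norm (b j)) summable_on UNIV"
      using assms by (intro summable_on_add) (auto simp: wser_def)
  qed (auto simp: distrib_left[symmetric] norm_triangle_ineq intro!: mult_left_mono)
  then show ?thesis
    using assms by (auto simp: wser_def distrib_right intro!: has_sum_add)
qed

lemma wser_diff:
  assumes "wser f a" "wser g b"
  shows "wser (\<lambda>z. f z - g z) (\<lambda>j. a j - b j)"
  using wser_add[OF assms(1) wser_cmult(1)[OF assms(2), of "-1"]] by simp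

lemma wser_monom_mult:
  assumes "wser f a"
  shows "wser (\<lambda>z. c * z powi i * f z) (\<lambda>j. c * a (j - i))"
    "wnorm (\<lambda>j. c * a (j - i)) \<le> norm c * \<nu> i * wnorm a"
proof -
  have bij: "bij_betw (\<lambda>j. j + i) UNIV (UNIV :: int set)"
    by (rule bij_betwI[where g = "\<lambda>j. j - i"]) auto
  have s: "(\<lambda>j. \<nu> (j + i) * norm (c * a j)) summable_on UNIV"
    and le: "(\<Sum>\<^sub>\<infinity>j. \<nu> (j + i) * norm (c * a j)) \<le> norm c * \<nu> i * wnorm a"
  proof -
    have 1: "\<nu> (j + i) * norm (c * a j) \<le> (norm c * \<nu> i) * (\<nu> j * norm (a j))" for j
      using mult_right_mono[OF weight_add[of j i], of "norm (c * a j)"]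
      by (simp add: norm_mult mult_ac)
    have 2: "(\<lambda>j. (norm c * \<nu> i) * (\<nu> j * norm (a j))) summable_on UNIV"
      using assms by (intro summable_on_cmult_right) (auto simp: wser_def)
    show s: "(\<lambda>j. \<nu> (j + i) * norm (c * a j)) summable_on UNIV"
      by (rule summable_on_comparison_test[OF 2]) (auto simp: 1)
    have "(\<Sum>\<^sub>\<infinity>j. \<nu> (j + i) * norm (c * a j)) \<le> (\<Sum>\<^sub>\<infinity>j. (norm c * \<nu> i) * (\<nu> j * norm (a j)))"
      by (intro infsum_mono s 2 1)
    then show "(\<Sum>\<^sub>\<infinity>j. \<nu> (j + i) * norm (c * a j)) \<le> norm c * \<nu> i * wnorm a"
      by (simp add: infsum_cmult_right' wnorm_def)
  qed
  show "wnorm (\<lambda>j. c * a (j - i)) \<le> norm c * \<nu> i * wnorm a"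
    using le infsum_reindex_bij_betw[OF bij, of "\<lambda>j. \<nu> j * norm (c * a (j - i))"]
    unfolding wnorm_def by simp
  have "((\<lambda>j. c * a (j - i) * z powi j) has_sum c * z powi i * f z) UNIV" if "z \<in> annulus A" for z
  proof -
    have "((\<lambda>j. (c * z powi i) * (a j * z powi j)) has_sum (c * z powi i) * f z) UNIV"
      using wser_has_sum[OF assms that] by (rule has_sum_cmult_right)
    moreover have "(c * z powi i) * (a j * z powi j) = c * a (j + i - i) * z powi (j + i)" for j
      using annulus_nonzero[OF that] by (simp add: power_int_add)
    ultimately show ?thesis
      using has_sum_reindex_bij_betw[OF bij, of "\<lambda>j. c * a (j - i) * z powi j"] by simp
  qed
  moreover have "(\<lambda>j. \<nu> j * norm (c * a (j - i))) summable_on UNIV"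
    using s summable_on_reindex_bij_betw[OF bij, of "\<lambda>j. \<nu> j * norm (c * a (j - i))"] by simp
  ultimately show "wser (\<lambda>z. c * z powi i * f z) (\<lambda>j. c * a (j - i))"
    by (simp add: wser_def)
qed

text \<open>Completeness of the algebra in concrete form: \<open>\<nu> j * norm (a i j)\<close> is
  summable over pairs, so Fubini lets the norms, and the series at each \<open>z\<close>, be summed
  in either order.\<close>

lemma wser_infsum:
  fixes I :: "'i set"
  assumes ser: "\<And>i. i \<in> I \<Longrightarrow> wser (f i) (a i)"
    and sm: "(\<lambda>i. wnorm (a i)) summable_on I"
  shows "wser (\<lambda>z. \<Sum>\<^sub>\<infinity>i\<in>I. f i z) (\<lambda>j. \<Sum>\<^sub>\<infinity>i\<in>I. a i j)"
    and "wnorm (\<lambda>j. \<Sum>\<^sub>\<infinity>i\<in>I. a i j) \<le> (\<Sum>\<^sub>\<infinity>i\<in>I. wnorm (a i))"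
    and "\<And>j. (\<lambda>i. norm (a i j)) summable_on I"
proof -
  define u where "u = (\<lambda>i j. \<nu> j * norm (a i j))"
  have u0: "0 \<le> u i j" for i j by (simp add: u_def)
  have usum: "(\<lambda>(i, j). u i j) summable_on I \<times> UNIV"
  proof (rule summable_on_SigmaI[where g = "\<lambda>i. wnorm (a i)"])
    fix i assume "i \<in> I"
    then show "((\<lambda>j. case (i, j) of (i, j) \<Rightarrow> u i j) has_sum wnorm (a i)) UNIV"
      using wser_summable[OF ser[of i]] by (simp add: u_def wnorm_def)
  qed (use sm u0 in auto)
  have usum': "(\<lambda>(j, i). u i j) summable_on UNIV \<times> I"
    using usum by (subst summable_on_swap) (simp add: case_prod_unfold)
  have ui: "(\<lambda>i. u i j) summable_on I" for j
    using summable_on_SigmaD1[OF usum', of j] by simp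
  have aj: "(\<lambda>i. norm (a i j)) summable_on I" for j
    using summable_on_cmult_right[OF ui[of j], of "1 / \<nu> j"] by (simp add: u_def less_imp_neq[OF weight_pos, symmetric])
  then show "\<And>j. (\<lambda>i. norm (a i j)) summable_on I" .
  have s1: "(\<lambda>j. \<Sum>\<^sub>\<infinity>i\<in>I. u i j) summable_on UNIV"
    using summable_on_Sigma_banach[of "\<lambda>j i. u i j" UNIV "\<lambda>_. I"] usum' by simp
  have le: "\<nu> j * norm (\<Sum>\<^sub>\<infinity>i\<in>I. a i j) \<le> (\<Sum>\<^sub>\<infinity>i\<in>I. u i j)" for j
    unfolding u_def infsum_cmult_right' by (intro mult_left_mono norm_infsum_bound aj) auto
  have s2: "(\<lambda>j. \<nu> j * norm (\<Sum>\<^sub>\<infinity>i\<in>I. a i j)) summable_on UNIV"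
    by (rule summable_on_comparison_test[OF s1]) (use le in auto)
  have "wnorm (\<lambda>j. \<Sum>\<^sub>\<infinity>i\<in>I. a i j) \<le> (\<Sum>\<^sub>\<infinity>j. \<Sum>\<^sub>\<infinity>i\<in>I. u i j)"
    unfolding wnorm_def by (intro infsum_mono s1 s2 le)
  also have "\<dots> = (\<Sum>\<^sub>\<infinity>i\<in>I. wnorm (a i))"
    using infsum_swap_banach[OF usum] by (simp add: wnorm_def u_def)
  finally show "wnorm (\<lambda>j. \<Sum>\<^sub>\<infinity>i\<in>I. a i j) \<le> (\<Sum>\<^sub>\<infinity>i\<in>I. wnorm (a i))" .
  have "((\<lambda>j. (\<Sum>\<^sub>\<infinity>i\<in>I. a i j) * z powi j) has_sum (\<Sum>\<^sub>\<infinity>i\<in>I. f i z)) UNIV" if z: "z \<in> annulus A" for z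
  proof -
    have "(\<lambda>p. norm (case p of (i, j) \<Rightarrow> a i j * z powi j)) summable_on I \<times> UNIV"
    proof (rule summable_on_comparison_test[OF usum])
      fix p :: "'i \<times> int"
      show "norm (case p of (i, j) \<Rightarrow> a i j * z powi j) \<le> (case p of (i, j) \<Rightarrow> u i j)"
        using mult_right_mono[OF norm_powi_le[OF z, of "snd p"], of "norm (a (fst p) (snd p))"]
        by (simp add: u_def norm_mult mult.commute case_prod_unfold)
    qed auto
    then have S: "(\<lambda>(i, j). a i j * z powi j) summable_on I \<times> UNIV"
      by (rule abs_summable_summable)
    then have S': "(\<lambda>(j, i). a i j * z powi j) summable_on UNIV \<times> I"
      by (subst summable_on_swap) (simp add: case_prod_unfold)
    have "(\<Sum>\<^sub>\<infinity>j. (\<Sum>\<^sub>\<infinity>i\<in>I. a i j) * z powi j) = (\<Sum>\<^sub>\<infinity>i\<in>I. \<Sum>\<^sub>\<infinity>j. a i j * z powi j)"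
      using infsum_swap_banach[OF S] by (simp add: infsum_cmult_left')
    also have "\<dots> = (\<Sum>\<^sub>\<infinity>i\<in>I. f i z)"
      using wser_has_sum[OF ser z] by (intro infsum_cong) (simp add: has_sum_iff)
    moreover have "(\<lambda>j. (\<Sum>\<^sub>\<infinity>i\<in>I. a i j) * z powi j) summable_on UNIV"
      using summable_on_Sigma_banach[of "\<lambda>j i. a i j * z powi j" UNIV "\<lambda>_. I"] S'
      by (simp add: infsum_cmult_left')
    ultimately show ?thesis by (simp add: has_sum_iff)
  qed
  then show "wser (\<lambda>z. \<Sum>\<^sub>\<infinity>i\<in>I. f i z) (\<lambda>j. \<Sum>\<^sub>\<infinity>i\<in>I. a i j)"
    using s2 by (simp add: wser_def)
qed

text \<open>The product is the series over \<open>i\<close> of the shifted copies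
  \<open>a i * z powi i * g z\<close>, each of norm at most
  \<open>norm (a i) * \<nu> i * wnorm b\<close>.\<close>

lemma wser_mult:
  assumes f: "wser f a" and g: "wser g b"
  shows "wser (\<lambda>z. f z * g z) (\<lambda>j. \<Sum>\<^sub>\<infinity>i. a i * b (j - i))"
    and "wnorm (\<lambda>j. \<Sum>\<^sub>\<infinity>i. a i * b (j - i)) \<le> wnorm a * wnorm b"
    and "\<And>j. (\<lambda>i. norm (a i * b (j - i))) summable_on UNIV"
proof -
  have s: "(\<lambda>i. norm (a i) * \<nu> i * wnorm b) summable_on UNIV"
    using wser_summable[OF f] by (intro summable_on_cmult_left) (simp add: mult.commute)
  have sm: "(\<lambda>i. wnorm (\<lambda>j. a i * b (j - i))) summable_on UNIV"
    by (rule summable_on_comparison_test[OF s]) (use wser_monom_mult(2)[OF g] wnorm_nonneg in auto)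
  note * = wser_infsum[OF wser_monom_mult(1)[OF g] sm]
  have "wnorm (\<lambda>j. \<Sum>\<^sub>\<infinity>i. a i * b (j - i)) \<le> (\<Sum>\<^sub>\<infinity>i. wnorm (\<lambda>j. a i * b (j - i)))" by (rule *(2))
  also have "\<dots> \<le> (\<Sum>\<^sub>\<infinity>i. norm (a i) * \<nu> i * wnorm b)"
    by (intro infsum_mono s sm wser_monom_mult(2)[OF g])
  also have "\<dots> = wnorm a * wnorm b"
    by (simp add: infsum_cmult_left' wnorm_def mult.commute)
  finally show "wnorm (\<lambda>j. \<Sum>\<^sub>\<infinity>i. a i * b (j - i)) \<le> wnorm a * wnorm b" .
  show "(\<lambda>i. norm (a i * b (j - i))) summable_on UNIV" for j by (rule *(3))
  show "wser (\<lambda>z. f z * g z) (\<lambda>j. \<Sum>\<^sub>\<infinity>i. a i * b (j - i))"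
    by (rule wser_cong[OF *(1)])
      (use wser_has_sum[OF f] in \<open>simp add: infsum_cmult_left' has_sum_iff\<close>)
qed

lemma wbd_mult:
  assumes f: "wbd S f B" and g: "wbd S g C" and S: "\<And>i j. i \<in> S \<Longrightarrow> j \<in> S \<Longrightarrow> i + j \<in> S"
  shows "wbd S (\<lambda>z. f z * g z) (B * C)"
proof -
  obtain a b where a: "wser f a" "\<forall>j. j \<notin> S \<longrightarrow> a j = 0" "wnorm a \<le> B"
    and b: "wser g b" "\<forall>j. j \<notin> S \<longrightarrow> b j = 0" "wnorm b \<le> C"
    using f g unfolding wbd_def by blast
  have "(\<Sum>\<^sub>\<infinity>i. a i * b (j - i)) = 0" if "j \<notin> S" for j
  proof (rule infsum_0)
    fix i show "a i * b (j - i) = 0"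
      using S[of i "j - i"] a(2) b(2) that by auto
  qed
  moreover have "wnorm (\<lambda>j. \<Sum>\<^sub>\<infinity>i. a i * b (j - i)) \<le> B * C"
    using wser_mult(2)[OF a(1) b(1)]
      mult_mono[OF a(3) b(3) wbd_nonneg[OF f] wnorm_nonneg] by (rule order_trans)
  ultimately show ?thesis
    unfolding wbd_def using wser_mult(1)[OF a(1) b(1)] by blast
qed

lemma wbd_cmult:
  assumes "wbd S f B"
  shows "wbd S (\<lambda>z. c * f z) (norm c * B)"
proof -
  obtain a where a: "wser f a" "\<forall>j. j \<notin> S \<longrightarrow> a j = 0" "wnorm a \<le> B"
    using assms unfolding wbd_def by blast
  show ?thesis unfolding wbd_def
    by (rule exI[of _ "\<lambda>j. c * a j"])
      (use a wser_cmult[OF a(1)] in \<open>auto intro!: mult_left_mono\<close>)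
qed

lemma wser_monom: "wser (\<lambda>z. c * z powi i) (\<lambda>j. if j = i then c else 0)"
  and wnorm_monom: "wnorm (\<lambda>j. if j = i then c else 0) = norm c * \<nu> i"
proof -
  have eq: "(\<lambda>j. \<nu> j * norm (if j = i then c else 0)) = (\<lambda>j. if j = i then norm c * \<nu> i else 0)"
    by auto
  show "wnorm (\<lambda>j. if j = i then c else 0) = norm c * \<nu> i"
    unfolding wnorm_def eq by (rule infsumI[OF has_sum_single])
  have "(\<lambda>j. (if j = i then c else 0) * z powi j) = (\<lambda>j. if j = i then c * z powi i else 0)" for z
    by auto
  then show "wser (\<lambda>z. c * z powi i) (\<lambda>j. if j = i then c else 0)"
    unfolding wser_def eq by (auto intro!: has_sum_single has_sum_imp_summable[OF has_sum_single])
qed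

lemma wbd_monom: "i \<in> S \<Longrightarrow> wbd S (\<lambda>z. c * z powi i) (norm c * \<nu> i)"
  unfolding wbd_def using wser_monom wnorm_monom by (intro exI[of _ "\<lambda>j. if j = i then c else 0"]) auto

lemma wbd_infsum:
  assumes f: "\<And>i. i \<in> I \<Longrightarrow> wbd S (f i) (B i)" and B: "B summable_on I"
  shows "wbd S (\<lambda>z. \<Sum>\<^sub>\<infinity>i\<in>I. f i z) (\<Sum>\<^sub>\<infinity>i\<in>I. B i)"
proof -
  obtain a where a: "\<And>i. i \<in> I \<Longrightarrow> wser (f i) (a i)" "\<And>i j. i \<in> I \<Longrightarrow> j \<notin> S \<Longrightarrow> a i j = 0"
    "\<And>i. i \<in> I \<Longrightarrow> wnorm (a i) \<le> B i"
    using f unfolding wbd_def by metis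
  have sm: "(\<lambda>i. wnorm (a i)) summable_on I"
    by (rule summable_on_comparison_test[OF B]) (use a(3) wnorm_nonneg in auto)
  have le: "(\<Sum>\<^sub>\<infinity>i\<in>I. wnorm (a i)) \<le> (\<Sum>\<^sub>\<infinity>i\<in>I. B i)"
    by (intro infsum_mono sm B a)
  have "(\<Sum>\<^sub>\<infinity>i\<in>I. a i j) = 0" if "j \<notin> S" for j
    by (rule infsum_0) (use a(2) that in blast)
  moreover have "wnorm (\<lambda>j. \<Sum>\<^sub>\<infinity>i\<in>I. a i j) \<le> (\<Sum>\<^sub>\<infinity>i\<in>I. B i)"
    using wser_infsum(2)[OF a(1) sm] le by (rule order_trans)
  ultimately show ?thesis
    unfolding wbd_def using wser_infsum(1)[OF a(1) sm] by blast
qed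

lemma wbd_sums:
  assumes f: "\<And>k::nat. wbd S (f k) (B k)" and B: "summable B"
    and g: "\<And>z. z \<in> annulus A \<Longrightarrow> (\<lambda>k. f k z) sums g z"
  shows "wbd S g (suminf B)"
proof -
  have B': "B summable_on UNIV"
    using wbd_nonneg[OF f] B by (intro summable_nonneg_imp_summable_on) auto
  have "suminf B = infsum B UNIV"
    using has_sum_imp_sums[OF has_sum_infsum[OF B']] by (simp add: sums_iff)
  moreover have "(\<Sum>\<^sub>\<infinity>k. f k z) = g z" if "z \<in> annulus A" for z
  proof -
    have "summable (\<lambda>k. norm (f k z))"
      by (rule summable_comparison_test[OF _ B]) (use wbd_norm_le[OF f that] in auto)
    then have "((\<lambda>k. f k z) has_sum g z) UNIV"
      using g[OF that] by (rule norm_summable_imp_has_sum)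
    then show ?thesis by (simp add: has_sum_iff)
  qed
  ultimately show ?thesis
    using wbd_cong[OF wbd_infsum[OF f B']] by simp
qed

section \<open>Power series in the algebra: powers, exponential, logarithm. The factor
  \<open>\<nu> 0\<close> is the norm of the constant 1, which may exceed 1\<close>

lemma wbd_power:
  assumes f: "wbd S f B" and "0 \<in> S" and S: "\<And>i j. i \<in> S \<Longrightarrow> j \<in> S \<Longrightarrow> i + j \<in> S"
  shows "wbd S (\<lambda>z. f z ^ k) (\<nu> 0 * B ^ k)"
proof (induction k)
  case 0
  then show ?case using wbd_monom[OF \<open>0 \<in> S\<close>, of 1] by simp
next
  case (Suc k)
  have "wbd S (\<lambda>z. f z * f z ^ k) (B * (\<nu> 0 * B ^ k))" by (rule wbd_mult[OF f Suc S])
  then show ?case by (simp add: mult_ac)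
qed

lemma wbd_exp:
  assumes f: "wbd S f B" and "0 \<in> S" and S: "\<And>i j. i \<in> S \<Longrightarrow> j \<in> S \<Longrightarrow> i + j \<in> S"
  shows "\<exists>C. wbd S (\<lambda>z. exp (f z)) C"
proof -
  have "wbd S (\<lambda>z. exp (f z)) (\<Sum>k. norm (1 / fact k :: complex) * (\<nu> 0 * B ^ k))"
  proof (rule wbd_sums[OF wbd_cmult[OF wbd_power[OF assms]]])
    have "summable (\<lambda>k. \<nu> 0 * (inverse (fact k) * B ^ k))"
      by (intro summable_mult summable_exp)
    then show "summable (\<lambda>k. norm (1 / fact k :: complex) * (\<nu> 0 * B ^ k))"
      by (simp add: norm_divide field_simps)
    fix z show "(\<lambda>k. 1 / fact k * f z ^ k) sums exp (f z)"
      using exp_converges[of "f z"] by (simp add: scaleR_conv_of_real field_simps)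
  qed
  then show ?thesis by blast
qed

text \<open>The assumption bounds the powers rather than \<open>f\<close>: with \<open>C\<close>
  large the norm of \<open>f\<close> may exceed 1, yet the logarithmic series converges. Pointwise,
  \<open>norm (f z) ^ k \<le> C * q ^ k\<close> for all \<open>k\<close> still forces
  \<open>norm (f z) < 1\<close>.\<close>

lemma wbd_Ln:
  assumes pw: "\<And>k. wbd S (\<lambda>z. f z ^ k) (C * q ^ k)" and q: "0 \<le> q" "q < 1"
  shows "\<exists>D. wbd S (\<lambda>z. Ln (1 + f z)) D" and "\<And>z. z \<in> annulus A \<Longrightarrow> norm (f z) < 1"
proof -
  show lt: "norm (f z) < 1" if "z \<in> annulus A" for z
  proof (rule ccontr)
    assume "\<not> norm (f z) < 1"
    have "(\<lambda>k. C * q ^ k) \<longlonglongrightarrow> C * 0"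
      by (intro tendsto_intros LIMSEQ_power_zero) (use q in auto)
    then have "\<forall>\<^sub>F k in sequentially. C * q ^ k < 1" by (intro order_tendstoD) auto
    then obtain k where "C * q ^ k < 1" by (auto simp: eventually_sequentially)
    moreover have "norm (f z) ^ k \<le> C * q ^ k" using wbd_norm_le[OF pw that] by (simp add: norm_power)
    ultimately show False using one_le_power[of "norm (f z)" k] \<open>\<not> norm (f z) < 1\<close> by linarith
  qed
  have C: "0 \<le> C" using wbd_nonneg[OF pw[of 0]] by simp
  \<comment> \<open>At \<open>k = 0\<close> the coefficient is 0 because division by zero gives 0,
    so the logarithmic series effectively starts at \<open>k = 1\<close>.\<close>
  have "wbd S (\<lambda>z. Ln (1 + f z)) (\<Sum>k. norm (- ((- 1) ^ k / of_nat k) :: complex) * (C * q ^ k))"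
  proof (rule wbd_sums[OF wbd_cmult[OF pw]])
    show "summable (\<lambda>k. norm (- ((- 1) ^ k / of_nat k) :: complex) * (C * q ^ k))"
    proof (rule summable_comparison_test)
      show "summable (\<lambda>k. C * q ^ k)" using q by (intro summable_mult summable_geometric) auto
      have "norm (- ((- 1) ^ k / of_nat k) :: complex) \<le> 1" for k
        by (cases k) (auto simp: norm_divide norm_power simp del: of_nat_Suc)
      then show "\<exists>N. \<forall>k\<ge>N. norm (norm (- ((- 1) ^ k / of_nat k) :: complex) * (C * q ^ k)) \<le> C * q ^ k"
        using C q by (auto simp: abs_mult intro!: mult_left_le_one_le)
    qed
    fix z assume "z \<in> annulus A"
    have "(\<lambda>k. - ((- f z) ^ k) / of_nat k) sums Ln (1 + f z)"
      by (rule Ln_series'[OF lt[OF \<open>z \<in> annulus A\<close>]])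
    moreover have "- ((- f z) ^ k) / of_nat k = - ((- 1) ^ k / of_nat k) * f z ^ k" for k
      by (subst power_minus) simp
    ultimately show "(\<lambda>k. - ((- 1) ^ k / of_nat k) * f z ^ k) sums Ln (1 + f z)"
      by (simp only:)
  qed
  then show "\<exists>D. wbd S (\<lambda>z. Ln (1 + f z)) D" by blast
qed

lemma wser_continuous_on:
  assumes "wser f a"
  shows "continuous_on (annulus A) f"
proof (rule uniform_limit_theorem)
  show "uniform_limit (annulus A) (\<lambda>X z. \<Sum>j\<in>X. a j * z powi j) f (finite_subsets_at_top UNIV)"
  proof (rule Weierstrass_m_test_general')
    show "norm (a j * z powi j) \<le> \<nu> j * norm (a j)" if "z \<in> annulus A" for j z
      using mult_right_mono[OF norm_powi_le[OF that, of j], of "norm (a j)"]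
      by (simp add: norm_mult mult.commute)
  qed (use assms in \<open>auto simp: wser_def\<close>)
  show "\<forall>\<^sub>F X in finite_subsets_at_top UNIV. continuous_on (annulus A) (\<lambda>z. \<Sum>j\<in>X. a j * z powi j)"
    by (intro always_eventually allI continuous_intros) (auto dest: annulus_nonzero)
qed auto

end

section \<open>Laurent coefficients, annuli and growth of weights\<close>

lemma has_integral_cis:
  "((\<lambda>\<theta>. cis (of_int k * \<theta>)) has_integral (if k = 0 then complex_of_real (2 * pi) else 0)) {-pi..pi}"
proof (cases "k = 0")
  case True
  then show ?thesis
    using has_integral_const_real[of "1::complex" "-pi" pi] by (simp add: scaleR_conv_of_real)
next
  case False
  let ?F = "\<lambda>z. exp (\<i> * of_int k * z) / (\<i> * of_int k)"
  have "((\<lambda>\<theta>. ?F (of_real \<theta>)) has_vector_derivative cis (of_int k * x)) (at x within {-pi..pi})" for x :: real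
  proof (rule has_vector_derivative_real_field)
    show "(?F has_field_derivative cis (of_int k * x)) (at (of_real x))"
      using False by (auto intro!: derivative_eq_intros simp: cis_conv_exp mult_ac)
  qed
  then have "((\<lambda>\<theta>. cis (of_int k * \<theta>)) has_integral (?F (of_real pi) - ?F (of_real (-pi)))) {-pi..pi}"
    by (intro fundamental_theorem_of_calculus) auto
  moreover have "?F (of_real pi) - ?F (of_real (-pi)) = 0"
  proof -
    have "exp (\<i> * of_int k * of_real pi) = exp (\<i> * of_int k * of_real (- pi))"
      unfolding exp_eq by (intro exI[of _ k]) (simp add: algebra_simps)
    then show ?thesis by simp
  qed
  ultimately show ?thesis using False by simp
qed

text \<open>\<open>a j * r powi j\<close> is a mean over the circle of \<open>f\<close> times a
  unimodular factor. Integrating a finite partial sum \<open>g\<close>, uniformly within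
  \<open>e\<close> of \<open>f\<close>, avoids exchanging the integral with the infinite
  sum.\<close>

lemma laurent_coeff_bound:
  fixes a :: "int \<Rightarrow> complex"
  assumes r: "r > 0"
    and sm: "(\<lambda>j. norm (a j) * r powi j) summable_on UNIV"
    and f: "\<And>z. norm z = r \<Longrightarrow> ((\<lambda>j. a j * z powi j) has_sum f z) UNIV"
    and M: "\<And>z. norm z = r \<Longrightarrow> norm (f z) \<le> M"
  shows "norm (a j) * r powi j \<le> M"
proof (rule field_le_epsilon)
  fix e :: real assume e: "e > 0"
  define u where "u = (\<lambda>j. norm (a j) * r powi j)"
  have u0: "0 \<le> u j" for j using r by (simp add: u_def)
  obtain F0 where F0: "finite F0" "dist (sum u F0) (infsum u UNIV) \<le> e"
    using infsum_finite_approximation[OF sm[folded u_def] e] by auto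
  \<comment> \<open>\<open>j\<close> is inserted so that the coefficient to be extracted occurs in
    the partial sum.\<close>
  define F where "F = insert j F0"
  have F: "finite F" "j \<in> F" using F0 by (auto simp: F_def)
  have us: "u summable_on UNIV" using sm by (simp add: u_def)
  have split: "infsum u UNIV = sum u F + infsum u (-F)"
    using infsum_Un_disjoint[of u F "-F"] F us
    by (simp add: summable_on_subset_banach[OF us] Compl_partition)
  have "sum u F0 \<le> sum u F" using F u0 by (intro sum_mono2) (auto simp: F_def)
  then have tail: "infsum u (-F) \<le> e" using split F0(2) by (simp add: dist_real_def)
  define g where "g = (\<lambda>z. \<Sum>i\<in>F. a i * z powi i)"
  have g: "norm (g z) \<le> M + e" if z: "norm z = r" for z
  proof -
    have nu: "norm (a i * z powi i) = u i" for i by (simp add: u_def norm_mult norm_power_int z)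
    have s: "(\<lambda>i. a i * z powi i) summable_on X" for X
      using f[OF z] summable_on_subset_banach has_sum_imp_summable by blast
    have "f z = g z + (\<Sum>\<^sub>\<infinity>i\<in>-F. a i * z powi i)"
      using infsum_Un_disjoint[of "\<lambda>i. a i * z powi i" F "-F"] F f[OF z] s
      by (simp add: Compl_partition has_sum_iff g_def)
    moreover have "norm (\<Sum>\<^sub>\<infinity>i\<in>-F. a i * z powi i) \<le> infsum u (-F)"
      using norm_infsum_bound[of "\<lambda>i. a i * z powi i" "-F"] summable_on_subset_banach[OF us, of "-F"]
      by (simp add: nu)
    ultimately show ?thesis using M[OF z] tail norm_triangle_ineq4[of "f z" "\<Sum>\<^sub>\<infinity>i\<in>-F. a i * z powi i"] by simp
  qed
  have expand: "cis (- (of_int j * \<theta>)) * g (of_real r * cis \<theta>) = (\<Sum>i\<in>F. a i * of_real (r powi i) * cis (of_int (i - j) * \<theta>))" for \<theta>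
    unfolding g_def sum_distrib_left
  proof (rule sum.cong[OF refl])
    fix i
    have "cis \<theta> powi i = cis (of_int i * \<theta>)" by (simp add: cis_power_int)
    then have "cis (- (of_int j * \<theta>)) * (a i * (of_real r * cis \<theta>) powi i)
      = a i * of_real (r powi i) * (cis (of_int i * \<theta>) * cis (- (of_int j * \<theta>)))"
      by (simp add: power_int_mult_distrib of_real_power_int mult_ac)
    also have "cis (of_int i * \<theta>) * cis (- (of_int j * \<theta>)) = cis (of_int (i - j) * \<theta>)"
      by (simp add: cis_mult algebra_simps)
    finally show "cis (- (of_int j * \<theta>)) * (a i * (of_real r * cis \<theta>) powi i) = a i * of_real (r powi i) * cis (of_int (i - j) * \<theta>)" .
  qed
  have "((\<lambda>\<theta>. cis (- (of_int j * \<theta>)) * g (of_real r * cis \<theta>)) has_integral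
      (\<Sum>i\<in>F. a i * of_real (r powi i) * (if i - j = 0 then complex_of_real (2 * pi) else 0))) {-pi..pi}"
    unfolding expand by (intro has_integral_sum F(1) has_integral_mult_right has_integral_cis)
  also have "(\<Sum>i\<in>F. a i * of_real (r powi i) * (if i - j = 0 then complex_of_real (2 * pi) else 0))
      = (\<Sum>i\<in>F. if j = i then a i * of_real (r powi i) * complex_of_real (2 * pi) else 0)"
    by (intro sum.cong) auto
  also have "\<dots> = a j * of_real (r powi j) * complex_of_real (2 * pi)"
    using F by simp
  finally have "norm (a j * of_real (r powi j) * complex_of_real (2 * pi)) \<le> (M + e) * measure lborel (cbox (-pi) pi)"
  proof (intro has_integral_bound)
    show "0 \<le> M + e" using order_trans[OF norm_ge_zero g[of "of_real r"]] r by simp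
    show "norm (cis (- (of_int j * \<theta>)) * g (of_real r * cis \<theta>)) \<le> M + e" for \<theta>
      using g[of "of_real r * cis \<theta>"] r by (simp add: norm_mult)
  qed (simp add: cbox_interval)
  then have "(norm (a j) * r powi j) * (2 * pi) \<le> (M + e) * (2 * pi)"
    using r by (simp add: norm_mult norm_power_int)
  then show "norm (a j) * r powi j \<le> M + e" by simp
qed

section \<open>Compactness of annuli and growth of weights\<close>

lemma annulus_iff: "z \<in> annulus A \<longleftrightarrow> z \<noteq> 0 \<and> \<bar>ln (norm z)\<bar> \<le> A"
proof (cases "z = 0")
  case False
  then have "exp (-A) \<le> norm z \<longleftrightarrow> -A \<le> ln (norm z)" "norm z \<le> exp A \<longleftrightarrow> ln (norm z) \<le> A"
    by (metis exp_le_cancel_iff exp_ln zero_less_norm_iff)+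
  then show ?thesis using False by (auto simp: annulus_def)
qed (auto simp: annulus_def)

lemma compact_annulus: "compact (annulus A)"
proof -
  have "annulus A = cball 0 (exp A) \<inter> {z. exp (-A) \<le> norm z}"
    by (auto simp: annulus_def)
  moreover have "closed {z::complex. exp (-A) \<le> norm z}"
    by (intro closed_Collect_le continuous_intros)
  ultimately show ?thesis by (simp add: compact_Int_closed)
qed

lemma annulus_mono: "A \<le> B \<Longrightarrow> annulus A \<subseteq> annulus B"
  by (auto simp: annulus_iff)

text \<open>The points of \<open>annulus (A + 1)\<close> with \<open>norm (p z) \<le> c\<close> form
  a compact set missing \<open>annulus A\<close>, so the least value of
  \<open>\<bar>ln (norm z)\<bar>\<close> on that set lies strictly above \<open>A\<close>.\<close>

lemma bounded_below_on_larger_annulus: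
  fixes p :: "complex \<Rightarrow> complex"
  assumes p: "continuous_on (annulus (A + 1)) p" and "c < d"
    and d: "\<And>z. z \<in> annulus A \<Longrightarrow> d \<le> norm (p z)"
  obtains e where "0 < e" "e \<le> 1" "\<And>z. z \<in> annulus (A + e) \<Longrightarrow> c < norm (p z)"
proof -
  define T where "T = {z \<in> annulus (A + 1). norm (p z) \<le> c}"
  have "closedin (top_of_set (annulus (A + 1))) (annulus (A + 1) \<inter> (\<lambda>z. norm (p z)) -` {..c})"
    by (intro continuous_closedin_preimage continuous_intros p closed_atMost)
  moreover have "annulus (A + 1) \<inter> (\<lambda>z. norm (p z)) -` {..c} = T" by (auto simp: T_def)
  ultimately have T: "compact T" using compact_annulus closedin_compact by metis
  show ?thesis
  proof (cases "T = {}")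
    case True
    then show ?thesis using that[of 1] by (force simp: T_def)
  next
    case False
    have "continuous_on T (\<lambda>z. \<bar>ln (norm z)\<bar>)"
      by (intro continuous_intros) (auto simp: T_def dest: annulus_nonzero)
    then obtain z0 where z0: "z0 \<in> T" "\<And>z. z \<in> T \<Longrightarrow> \<bar>ln (norm z0)\<bar> \<le> \<bar>ln (norm z)\<bar>"
      using continuous_attains_inf[OF T False] by blast
    have "z0 \<notin> annulus A" using d[of z0] z0(1) \<open>c < d\<close> by (auto simp: T_def)
    then have gt: "A < \<bar>ln (norm z0)\<bar>" using z0(1) by (simp add: annulus_iff T_def)
    \<comment> \<open>Half of the gap keeps the enlarged annulus away from \<open>T\<close>; the cap
      1 keeps it where \<open>p\<close> is continuous.\<close>
    define e where "e = min 1 ((\<bar>ln (norm z0)\<bar> - A) / 2)"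
    have e: "0 < e" "e \<le> 1" "A + e < \<bar>ln (norm z0)\<bar>"
      using gt min.cobounded2[of 1 "(\<bar>ln (norm z0)\<bar> - A) / 2"] by (auto simp: e_def simp del: min.cobounded2)
    show ?thesis
    proof (rule that[OF e(1,2)])
      fix z assume z: "z \<in> annulus (A + e)"
      then have "z \<notin> T" using z0(2)[of z] e(3) by (auto simp: annulus_iff)
      moreover have "z \<in> annulus (A + 1)" using z annulus_mono[of "A + e" "A + 1"] e(2) by auto
      ultimately show "c < norm (p z)" by (auto simp: T_def)
    qed
  qed
qed

text \<open>Fekete's argument: the limit defining the growth rate is the infimum of \<open>ln (\<nu> k) / k\<close>.\<close>
lemma beurling_A_bounds:
  assumes \<nu>: "beurling_weight \<nu>"
  shows "0 \<le> beurling_A \<nu>" "exp (beurling_A \<nu> * \<bar>real_of_int j\<bar>) \<le> \<nu> j"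
    and "0 < \<epsilon> \<Longrightarrow> \<exists>C. \<forall>j. \<nu> j \<le> C * exp ((beurling_A \<nu> + \<epsilon>) * \<bar>real_of_int j\<bar>)"
proof -
  have ge1: "1 \<le> \<nu> j" and sym: "\<nu> (- j) = \<nu> j" and sub: "\<nu> (j + k) \<le> \<nu> j * \<nu> k" for j k
    using \<nu> by (auto simp: beurling_weight_def)
  have pos: "0 < \<nu> j" for j using ge1[of j] by linarith
  have abs: "\<nu> (int (nat \<bar>j\<bar>)) = \<nu> j" for j using sym[of j] by (auto simp: abs_if)
  define x where "x = (\<lambda>k::nat. ln (\<nu> (int k)) / real k)"
  define A where "A = (INF k\<in>{1..}. x k)"
  have x0: "0 \<le> x k" for k using ge1 by (simp add: x_def)
  have bdd: "bdd_below (x ` {1..})" using x0 by (auto intro: bdd_belowI[of _ 0])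
  have A_le: "A \<le> x k" if "1 \<le> k" for k unfolding A_def by (rule cINF_lower[OF bdd]) (use that in auto)
  have A0: "0 \<le> A" unfolding A_def by (rule cINF_greatest) (use x0 in auto)
  have upper: "\<exists>C\<ge>1. \<forall>k::nat. \<nu> (int k) \<le> C * exp ((A + \<epsilon>) * real k)" if \<epsilon>: "0 < \<epsilon>" for \<epsilon>
  proof -
    obtain m where m: "1 \<le> m" "x m < A + \<epsilon>"
      using cINF_less_iff[of "{1..}" x "A + \<epsilon>"] bdd \<epsilon> by (auto simp: A_def)
    have "ln (\<nu> (int m)) \<le> (A + \<epsilon>) * real m" using m by (simp add: x_def field_simps)
    then have "exp (ln (\<nu> (int m))) \<le> exp ((A + \<epsilon>) * real m)" by simp
    then have vm: "\<nu> (int m) \<le> exp ((A + \<epsilon>) * real m)" using pos by simp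
    \<comment> \<open>For \<open>k = q * m + r\<close> with \<open>r < m\<close>, the remainder
      contributes at most \<open>C\<close>, whatever \<open>k\<close> is.\<close>
    define C where "C = Max ((\<lambda>r. \<nu> (int r)) ` {..<m})"
    have C: "\<nu> (int r) \<le> C" if "r < m" for r unfolding C_def by (rule Max_ge) (use that in auto)
    have C1: "1 \<le> C" using C[of 0] ge1[of 0] m by auto
    have step: "\<nu> (int (q * m + r)) \<le> \<nu> (int m) ^ q * \<nu> (int r)" for q r
    proof (induction q)
      case (Suc q)
      have "\<nu> (int (Suc q * m + r)) \<le> \<nu> (int m) * \<nu> (int (q * m + r))"
        using sub[of "int m" "int (q * m + r)"] by (simp add: algebra_simps)
      also have "\<dots> \<le> \<nu> (int m) * (\<nu> (int m) ^ q * \<nu> (int r))"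
        by (intro mult_left_mono Suc less_imp_le[OF pos])
      finally show ?case by simp
    qed simp
    have "\<nu> (int k) \<le> C * exp ((A + \<epsilon>) * real k)" for k
    proof -
      have "\<nu> (int k) \<le> \<nu> (int m) ^ (k div m) * \<nu> (int (k mod m))" using step[of "k div m" "k mod m"] by simp
      also have "\<dots> \<le> exp ((A + \<epsilon>) * real m) ^ (k div m) * C"
        using m C by (intro mult_mono power_mono vm) (auto intro: less_imp_le[OF pos])
      also have "exp ((A + \<epsilon>) * real m) ^ (k div m) = exp ((A + \<epsilon>) * real (m * (k div m)))"
        by (simp add: exp_of_nat_mult[symmetric] mult_ac)
      also have "\<dots> \<le> exp ((A + \<epsilon>) * real k)"
        using A0 \<epsilon> by (auto intro!: mult_left_mono simp del: of_nat_mult)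
      finally show ?thesis using C1 by (simp add: mult.commute)
    qed
    then show ?thesis using C1 by blast
  qed
  have "x \<longlonglongrightarrow> A"
  proof (rule LIMSEQ_I)
    fix e :: real assume e: "0 < e"
    obtain C where C: "1 \<le> C" "\<And>k. \<nu> (int k) \<le> C * exp ((A + e / 2) * real k)"
      using upper[of "e / 2"] e by auto
    obtain N where N: "N \<ge> 1" "real N > 2 * ln C / e"
      by (metis less_le_trans le_max_iff_disj of_nat_le_iff order_refl reals_Archimedean2 max.cobounded1)
    have "norm (x k - A) < e" if k: "k \<ge> N" for k
    proof -
      have k0: "real k > 0" "real k > 2 * ln C / e" using k N by auto
      have "ln (\<nu> (int k)) \<le> ln (C * exp ((A + e / 2) * real k))"
        using C pos by (subst ln_le_cancel_iff) auto
      also have "\<dots> = ln C + (A + e / 2) * real k" using C by (simp add: ln_mult)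
      also have "ln C < e / 2 * real k" using k0 e by (simp add: field_simps)
      finally have "ln (\<nu> (int k)) < (A + e) * real k" by (simp add: algebra_simps)
      then have "x k < A + e" using k0 by (simp add: x_def field_simps)
      then show ?thesis using A_le[of k] k N by auto
    qed
    then show "\<exists>N. \<forall>k\<ge>N. norm (x k - A) < e" by blast
  qed
  then have A: "beurling_A \<nu> = A" by (simp add: beurling_A_def x_def limI)
  show "0 \<le> beurling_A \<nu>" using A A0 by simp
  show "exp (beurling_A \<nu> * \<bar>real_of_int j\<bar>) \<le> \<nu> j"
  proof (cases "j = 0")
    case False
    define k where "k = nat \<bar>j\<bar>"
    have k: "1 \<le> k" "real k = \<bar>real_of_int j\<bar>" using False by (auto simp: k_def)
    have "A * real k \<le> ln (\<nu> j)"
      using A_le[OF k(1)] k abs[of j] by (simp add: x_def field_simps k_def)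
    then have "exp (A * real k) \<le> exp (ln (\<nu> j))" by simp
    then show ?thesis using pos[of j] k by (simp add: A)
  qed (use ge1 in auto)
  show "\<exists>C. \<forall>j. \<nu> j \<le> C * exp ((beurling_A \<nu> + \<epsilon>) * \<bar>real_of_int j\<bar>)" if "0 < \<epsilon>"
  proof -
    obtain C where C: "\<And>k. \<nu> (int k) \<le> C * exp ((A + \<epsilon>) * real k)" using upper[OF \<open>0 < \<epsilon>\<close>] by auto
    have "\<nu> j \<le> C * exp ((A + \<epsilon>) * \<bar>real_of_int j\<bar>)" for j
      using C[of "nat \<bar>j\<bar>"] abs[of j] by simp
    then show ?thesis unfolding A by blast
  qed
qed

lemma beurling_weight_exp: "0 \<le> A \<Longrightarrow> beurling_weight (\<lambda>j. exp (A * \<bar>real_of_int j\<bar>))"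
  by (auto simp: beurling_weight_def exp_add[symmetric] distrib_left[symmetric] intro!: mult_left_mono)

lemma wiener_weight_exp: "0 \<le> A \<Longrightarrow> wiener_weight (\<lambda>j. exp (A * \<bar>real_of_int j\<bar>)) A"
  by unfold_locales (auto intro: beurling_weight_exp)

lemma summable_on_exp_abs_int:
  assumes "0 < c"
  shows "(\<lambda>j. exp (- (c * \<bar>real_of_int j\<bar>))) summable_on UNIV"
proof -
  have s: "(\<lambda>k. exp (- (c * real k))) summable_on (UNIV :: nat set)"
  proof (rule summable_nonneg_imp_summable_on)
    have "exp (- (c * real k)) = exp (-c) ^ k" for k
      by (simp add: exp_of_nat_mult[symmetric] mult.commute)
    then show "summable (\<lambda>k. exp (- (c * real k)))" using assms by (simp add: summable_geometric)
  qed auto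
  have "(\<lambda>j. exp (- (c * \<bar>real_of_int j\<bar>))) summable_on (range int \<union> range (\<lambda>k. - int k))"
    using s by (intro summable_on_union) (auto simp: summable_on_reindex inj_on_def o_def)
  moreover have "range int \<union> range (\<lambda>k. - int k) = UNIV"
  proof -
    have "j \<in> range int \<union> range (\<lambda>k. - int k)" for j by (cases j rule: int_cases2) auto
    then show ?thesis by blast
  qed
  ultimately show ?thesis by simp
qed

text \<open>A continuous logarithm \<open>q\<close> of the loop differs from \<open>L\<close> plus
  the linear term 2 pi i m t by a continuous function with values in the multiples of 2 pi i, hence
  by a constant. Zero winding makes \<open>q\<close> close up and \<open>L\<close> closes up anyway,
  so the linear term has no increment over the loop.\<close>

lemma winding_zero_imp_power_zero:
  assumes f: "\<And>z. norm z = 1 \<Longrightarrow> f z = z powi m * exp (L z)"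
    and L: "continuous_on (sphere 0 1) L"
    and wind: "winding_number (\<lambda>t. f (cis (2 * pi * t))) 0 = 0"
  shows "m = 0"
proof -
  define p where "p = (\<lambda>t. cis (2 * pi * t * of_int m) * exp (L (cis (2 * pi * t))))"
  have fp: "f (cis (2 * pi * t)) = p t" for t
    by (simp add: f p_def cis_power_int mult_ac)
  have contL: "continuous_on {0..1} (\<lambda>t::real. L (cis (2 * pi * t)))"
    by (rule continuous_on_compose2[OF L]) (auto intro!: continuous_intros)
  have "path p" unfolding path_def p_def by (intro continuous_intros contL)
  moreover have "0 \<notin> path_image p" by (auto simp: path_image_def p_def)
  ultimately obtain q where q: "path q"
      "pathfinish q - pathstart q = 2 * of_real pi * \<i> * winding_number p 0"
      "\<And>t. t \<in> {0..1} \<Longrightarrow> p t = 0 + exp (q t)"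
    using winding_number_as_continuous_log by blast
  have q01: "q 1 = q 0"
    using q(2) wind by (simp add: fp pathfinish_def pathstart_def)
  define g where "g = (\<lambda>t. q t - L (cis (2 * pi * t)) - of_real (2 * pi * t * of_int m) * \<i>)"
  have contg: "continuous_on {0..1} g"
    unfolding g_def using q(1) by (intro continuous_intros contL) (simp add: path_def)
  have expg: "exp (g t) = 1" if "t \<in> {0..1}" for t
    using q(3)[OF that] by (simp add: g_def exp_diff p_def cis_conv_exp mult_ac)
  have "g constant_on {0..1}"
  proof (rule continuous_discrete_range_constant[OF _ contg])
    fix s :: real assume s: "s \<in> {0..1}"
    show "\<exists>e>0. \<forall>t. t \<in> {0..1} \<and> g t \<noteq> g s \<longrightarrow> e \<le> norm (g t - g s)"
    proof (intro exI[of _ "2 * pi"] conjI allI impI)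
      fix t assume t: "t \<in> {0..1} \<and> g t \<noteq> g s"
      obtain n k where "Re (g t) = 0" "Im (g t) = of_int (2 * n) * pi" "Re (g s) = 0" "Im (g s) = of_int (2 * k) * pi"
        using expg[of t] expg[OF s] t by (auto simp: exp_eq_1)
      then have nk: "g t = of_real (2 * of_int n * pi) * \<i>" "g s = of_real (2 * of_int k * pi) * \<i>"
        by (auto simp: complex_eq_iff)
      have "n \<noteq> k" using t nk by auto
      then have "1 \<le> \<bar>real_of_int (n - k)\<bar>" by linarith
      moreover have "g t - g s = of_real (2 * pi * of_int (n - k)) * \<i>"
        by (simp add: nk algebra_simps)
      ultimately show "2 * pi \<le> norm (g t - g s)" by (simp add: norm_mult abs_mult del: of_int_diff)
    qed auto
  qed auto
  then have "g 1 = g 0" unfolding constant_on_def by (metis atLeastAtMost_iff order_refl zero_le_one)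
  then show "m = 0" using q01 by (simp add: g_def)
qed

section \<open>The Wiener--Levy theorem\<close>

context wiener_weight
begin

text \<open>Cauchy's estimate on the unit circle with bound 0, applied to the difference. This turns
  identities of functions into identities of coefficients.\<close>

lemma wser_unique:
  assumes "wser f a" "wser f b"
  shows "a = b"
proof
  fix j
  define d where "d = (\<lambda>j. a j - b j)"
  have d: "wser (\<lambda>z. 0) d" using wser_diff[OF assms] by (simp add: d_def)
  have "(\<lambda>j. norm (d j) * 1 powi j) summable_on UNIV"
  proof (rule summable_on_comparison_test[OF wser_summable[OF d]])
    fix j show "norm (d j) * 1 powi j \<le> \<nu> j * norm (d j)"
      using mult_right_mono[OF weight_ge_1[of j], of "norm (d j)"] by simp
  qed auto
  then have "norm (d j) * 1 powi j \<le> 0"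
    by (rule laurent_coeff_bound[rotated])
      (use wser_has_sum[OF d one_in_annulus] in auto)
  then show "a j = b j" by (simp add: d_def)
qed

lemma wbd_add:
  assumes "wbd S f B" "wbd S g C"
  shows "wbd S (\<lambda>z. f z + g z) (B + C)"
proof -
  obtain a b where a: "wser f a" "\<forall>j. j \<notin> S \<longrightarrow> a j = 0" "wnorm a \<le> B"
    and b: "wser g b" "\<forall>j. j \<notin> S \<longrightarrow> b j = 0" "wnorm b \<le> C"
    using assms unfolding wbd_def by blast
  have "wnorm (\<lambda>j. a j + b j) \<le> (\<Sum>\<^sub>\<infinity>j. \<nu> j * norm (a j) + \<nu> j * norm (b j))"
    unfolding wnorm_def
    by (intro infsum_mono summable_on_add wser_summable[OF a(1)] wser_summable[OF b(1)]
        wser_summable[OF wser_add[OF a(1) b(1)]])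
      (simp add: distrib_left[symmetric] norm_triangle_ineq)
  also have "\<dots> = wnorm a + wnorm b"
    unfolding wnorm_def by (intro infsum_add wser_summable[OF a(1)] wser_summable[OF b(1)])
  finally have "wnorm (\<lambda>j. a j + b j) \<le> B + C" using a(3) b(3) by linarith
  then show ?thesis
    unfolding wbd_def using wser_add[OF a(1) b(1)] a(2) b(2)
    by (intro exI[of _ "\<lambda>j. a j + b j"]) auto
qed

text \<open>A zero in the hole gives \<open>z - \<zeta> = z * (1 - \<zeta> / z)\<close>, a zero
  outside gives \<open>- \<zeta> * (1 - z / \<zeta>)\<close>. For the exact exponential weight the
  powers of the small term have norm \<open>(norm c * exp A) ^ k\<close>, so the logarithmic series
  applies.\<close>

lemma linear_factor_log:
  assumes \<nu>: "\<And>j. \<nu> j = exp (A * \<bar>real_of_int j\<bar>)" and \<zeta>: "\<zeta> \<notin> annulus A"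
  shows "\<exists>m::int. \<exists>l B. wbd UNIV l B \<and> (\<forall>z\<in>annulus A. z - \<zeta> = z powi m * exp (l z))"
proof -
  have main: "\<exists>D. wbd UNIV (\<lambda>z. Ln (1 + c * z powi i)) D"
      "\<And>z. z \<in> annulus A \<Longrightarrow> norm (c * z powi i) < 1"
    if q: "norm c * exp A < 1" and i: "\<bar>i\<bar> = 1" for c and i :: int
  proof -
    have pw: "wbd UNIV (\<lambda>z. (c * z powi i) ^ k) (1 * (norm c * exp A) ^ k)" for k
    proof -
      have "wbd UNIV (\<lambda>z. c ^ k * z powi (i * int k)) (norm (c ^ k) * \<nu> (i * int k))"
        by (rule wbd_monom) simp
      moreover have "norm (c ^ k) * \<nu> (i * int k) = 1 * (norm c * exp A) ^ k"
        using i by (simp add: \<nu> norm_power power_mult_distrib abs_mult exp_of_nat_mult[symmetric] mult_ac flip: of_int_abs)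
      moreover have "c ^ k * z powi (i * int k) = (c * z powi i) ^ k" for z
        by (simp add: power_mult_distrib power_int_mult)
      ultimately show ?thesis by simp
    qed
    show "\<exists>D. wbd UNIV (\<lambda>z. Ln (1 + c * z powi i)) D"
      by (rule wbd_Ln(1)[OF pw]) (use q in auto)
    show "norm (c * z powi i) < 1" if "z \<in> annulus A" for z
      by (rule wbd_Ln(2)[OF pw _ _ that]) (use q in auto)
  qed
  have ne: "1 + x \<noteq> 0" if "norm x < 1" for x :: complex
  proof
    assume "1 + x = 0"
    then have "x = -1" by (simp add: add_eq_0_iff)
    then show False using that by simp
  qed
  show ?thesis
  proof (cases "norm \<zeta> < exp (-A)")
    case True
    then have q: "norm (-\<zeta>) * exp A < 1" by (simp add: exp_minus field_simps)
    obtain D where D: "wbd UNIV (\<lambda>z. Ln (1 + (-\<zeta>) * z powi (-1))) D" using main(1)[OF q, of "-1"] by auto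
    have "z - \<zeta> = z powi 1 * exp (Ln (1 + (-\<zeta>) * z powi (-1)))" if z: "z \<in> annulus A" for z
      using annulus_nonzero[OF z] ne[OF main(2)[OF q _ z, of "-1"]] by (simp add: field_simps)
    then show ?thesis using D by blast
  next
    case False
    then have big: "exp A < norm \<zeta>" using \<zeta> by (auto simp: annulus_def)
    then have \<zeta>0: "\<zeta> \<noteq> 0" by (auto simp: not_less[symmetric])
    then have q: "norm (- 1 / \<zeta>) * exp A < 1" using big by (simp add: norm_divide field_simps)
    obtain D where D: "wbd UNIV (\<lambda>z. Ln (1 + (- 1 / \<zeta>) * z powi 1)) D" using main(1)[OF q, of 1] by auto
    have "wbd UNIV (\<lambda>z. Ln (- \<zeta>)) (norm (Ln (- \<zeta>)) * \<nu> 0)"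
      using wbd_monom[of 0 UNIV "Ln (- \<zeta>)"] by simp
    note W = wbd_add[OF this D]
    have "z - \<zeta> = z powi 0 * exp (Ln (- \<zeta>) + Ln (1 + (- 1 / \<zeta>) * z powi 1))" if z: "z \<in> annulus A" for z
      using \<zeta>0 ne[OF main(2)[OF q _ z, of 1]] by (simp add: exp_add field_simps)
    then show ?thesis using W by blast
  qed
qed

text \<open>Roots are split off one at a time; none lies in the annulus, so each linear factor
  contributes its own power of \<open>z\<close> and its own logarithm.\<close>

lemma polynomial_log:
  assumes \<nu>: "\<And>j. \<nu> j = exp (A * \<bar>real_of_int j\<bar>)"
    and P: "\<And>z. z \<in> annulus A \<Longrightarrow> poly P z \<noteq> 0"
  shows "\<exists>m::int. \<exists>l B. wbd UNIV l B \<and> (\<forall>z\<in>annulus A. poly P z = z powi m * exp (l z))"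
  using P
proof (induction "degree P" arbitrary: P)
  case 0
  then obtain c where c: "P = [:c:]" by (metis degree_eq_zeroE)
  have "c \<noteq> 0" using "0.prems"[OF one_in_annulus[of 1]] by (simp add: c)
  then have "\<forall>z\<in>annulus A. poly P z = z powi 0 * exp (Ln c)" by (simp add: c)
  moreover have "wbd UNIV (\<lambda>z. Ln c) (norm (Ln c) * \<nu> 0)"
    using wbd_monom[of 0 UNIV "Ln c"] by simp
  ultimately show ?case by blast
next
  case (Suc n)
  then obtain \<zeta> where \<zeta>: "poly P \<zeta> = 0"
    using Fundamental_Theorem_Algebra.fundamental_theorem_of_algebra[of P] by (auto simp: constant_degree)
  then obtain Q where Q: "P = [:-\<zeta>, 1:] * Q" by (auto simp: poly_eq_0_iff_dvd dvd_def)
  have Q0: "Q \<noteq> 0" using Suc(2) Q by auto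
  have "degree P = degree [:-\<zeta>, 1:] + degree Q"
    unfolding Q by (rule degree_mult_eq) (use Q0 in auto)
  then have "degree Q = n" using Suc(2) by simp
  moreover have "\<And>z. z \<in> annulus A \<Longrightarrow> poly Q z \<noteq> 0" using Suc(3) by (auto simp: Q)
  ultimately obtain m l B where IH: "wbd UNIV l B" "\<forall>z\<in>annulus A. poly Q z = z powi m * exp (l z)"
    using Suc(1)[of Q] by metis
  have "\<zeta> \<notin> annulus A" using Suc(3) \<zeta> by auto
  from linear_factor_log[OF \<nu> this] obtain m' l' B'
    where L: "wbd UNIV l' B'" "\<forall>z\<in>annulus A. z - \<zeta> = z powi m' * exp (l' z)" by blast
  have "poly P z = z powi (m' + m) * exp (l' z + l z)" if z: "z \<in> annulus A" for z
  proof -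
    have "poly P z = (z - \<zeta>) * poly Q z" by (simp add: Q algebra_simps)
    also have "\<dots> = (z powi m' * exp (l' z)) * (z powi m * exp (l z))"
      using L(2) IH(2) z by simp
    finally show ?thesis using annulus_nonzero[OF z] by (simp add: power_int_add exp_add)
  qed
  then show ?case using wbd_add[OF L(1) IH(1)] by blast
qed

text \<open>Newman's argument: \<open>f\<close> is approximated by a Laurent polynomial \<open>p\<close>; the powers of
  \<open>1 / p\<close> are controlled by Cauchy's estimate on a slightly larger annulus, where \<open>1 / p\<close>
  is bounded by \<open>2 / \<delta>\<close>, and this beats the powers of the remainder, of norm at most \<open>\<delta> / 4\<close>.\<close>
theorem wiener_levy_log:
  assumes growth: "\<And>\<epsilon>. 0 < \<epsilon> \<Longrightarrow> \<exists>C. \<forall>j. \<nu> j \<le> C * exp ((A + \<epsilon>) * \<bar>real_of_int j\<bar>)"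
    and f: "wser f a" and nz: "\<And>z. z \<in> annulus A \<Longrightarrow> f z \<noteq> 0"
  shows "\<exists>m::int. \<exists>L B. wbd UNIV L B \<and> (\<forall>z\<in>annulus A. f z = z powi m * exp (L z))"
proof -
  have "annulus A \<noteq> {}" using one_in_annulus[of 1] by auto
  moreover have "continuous_on (annulus A) (\<lambda>z. norm (f z))"
    by (intro continuous_intros wser_continuous_on[OF f])
  ultimately obtain z0 where z0: "z0 \<in> annulus A" "\<And>z. z \<in> annulus A \<Longrightarrow> norm (f z0) \<le> norm (f z)"
    using continuous_attains_inf[OF compact_annulus] by metis
  define \<delta> where "\<delta> = norm (f z0)"
  have \<delta>: "0 < \<delta>" "\<And>z. z \<in> annulus A \<Longrightarrow> \<delta> \<le> norm (f z)" using z0 nz by (auto simp: \<delta>_def)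
  define u where "u = (\<lambda>j. \<nu> j * norm (a j))"
  have us: "u summable_on UNIV" using wser_summable[OF f] by (simp add: u_def)
  obtain F0 where F0: "finite F0" "dist (sum u F0) (infsum u UNIV) \<le> \<delta> / 4"
    using infsum_finite_approximation[OF us, of "\<delta> / 4"] \<delta> by auto
  obtain K0 where K0: "\<forall>j\<in>F0. \<bar>j\<bar> \<le> K0"
    using F0(1) by (metis finite_imageI Max_ge imageI)
  define K where "K = nat K0"
  \<comment> \<open>The symmetric range makes \<open>z powi int K * p z\<close> a polynomial, of
    degree at most \<open>2 * K\<close>.\<close>
  define F where "F = {- int K..int K}"
  have FF: "finite F" "F0 \<subseteq> F" using K0 by (force simp: F_def K_def)+
  define r where "r = (\<lambda>j. if j \<in> F then 0 else a j)"
  have wr: "wnorm r \<le> \<delta> / 4"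
  proof -
    have "infsum u UNIV = sum u F + infsum u (-F)"
      using infsum_Un_disjoint[of u F "-F"] FF us
      by (simp add: summable_on_subset_banach[OF us] Compl_partition)
    moreover have "sum u F0 \<le> sum u F" using FF by (intro sum_mono2) (auto simp: u_def)
    moreover have "wnorm r = infsum u (-F)"
      unfolding wnorm_def by (rule infsum_cong_neutral) (auto simp: r_def u_def)
    ultimately show ?thesis using F0(2) unfolding dist_real_def by linarith
  qed
  define p where "p = (\<lambda>z. \<Sum>j\<in>F. a j * z powi j)"
  have pser: "wser p (\<lambda>j. if j \<in> F then a j else 0)"
    unfolding wser_def
  proof (intro conjI ballI)
    show "(\<lambda>j. \<nu> j * norm (if j \<in> F then a j else 0)) summable_on UNIV"
      by (rule summable_on_comparison_test[OF us]) (auto simp: u_def)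
    show "((\<lambda>j. (if j \<in> F then a j else 0) * z powi j) has_sum p z) UNIV" for z
      by (rule has_sum_finite_neutralI[OF FF(1)]) (auto simp: p_def)
  qed
  have rser: "wser (\<lambda>z. f z - p z) r"
  proof -
    have "(\<lambda>j. a j - (if j \<in> F then a j else 0)) = r" by (auto simp: r_def)
    then show ?thesis using wser_diff[OF f pser] by simp
  qed
  have p_ge: "3 / 4 * \<delta> \<le> norm (p z)" if "z \<in> annulus A" for z
    using wser_norm_le[OF rser that] wr \<delta>(2)[OF that] norm_triangle_ineq2[of "f z" "p z"] by linarith
  have contp: "continuous_on (annulus (A + 1)) p"
    unfolding p_def by (intro continuous_intros) (auto simp: annulus_iff)
  \<comment> \<open>The bound \<open>3 / 4 * \<delta>\<close> on \<open>annulus A\<close> is relaxed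
    to \<open>\<delta> / 2\<close> on a larger annulus. Against a remainder of norm
    \<open>\<delta> / 4\<close> this leaves the ratio
    \<open>(\<delta> / 4) * (2 / \<delta>) = 1 / 2\<close>.\<close>
  obtain e where e: "0 < e" "e \<le> 1" "\<And>z. z \<in> annulus (A + e) \<Longrightarrow> \<delta> / 2 < norm (p z)"
    using bounded_below_on_larger_annulus[OF contp _ p_ge, of "\<delta> / 2"] \<delta> by auto
  define A' where "A' = A + e"
  have A': "0 \<le> A'" "annulus A \<subseteq> annulus A'" using A_nonneg e annulus_mono[of A A'] by (auto simp: A'_def)
  interpret W': wiener_weight "\<lambda>j. exp (A' * \<bar>real_of_int j\<bar>)" A' by (rule wiener_weight_exp[OF A'(1)])
  have p_nz: "p z \<noteq> 0" "norm (1 / p z) \<le> 2 / \<delta>" if "z \<in> annulus A'" for z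
    using e(3)[of z] that \<delta>(1)
      frac_le[of 1 1 "\<delta> / 2" "norm (p z)"] by (auto simp: A'_def norm_divide)
  define P where "P = (\<Sum>i\<le>2 * K. monom (a (int i - int K)) i)"
  have P: "poly P z = z powi int K * p z" if "z \<noteq> 0" for z
  proof -
    have "z powi int K * p z = (\<Sum>j\<in>F. a j * z powi (j + int K))"
      unfolding p_def sum_distrib_left using that by (intro sum.cong) (auto simp: power_int_add)
    also have "\<dots> = (\<Sum>i\<le>2 * K. a (int i - int K) * z powi (int i))"
      by (rule sum.reindex_bij_witness[of _ "\<lambda>i. int i - int K" "\<lambda>j. nat (j + int K)"]) (auto simp: F_def)
    finally show ?thesis by (simp add: P_def poly_sum poly_monom)
  qed
  have "poly P z \<noteq> 0" if "z \<in> annulus A'" for z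
    using P[of z] p_nz(1)[OF that] annulus_nonzero[OF that] by simp
  from W'.polynomial_log[OF refl this] obtain m' l B
    where l: "W'.wbd UNIV l B" "\<forall>z\<in>annulus A'. poly P z = z powi m' * exp (l z)" by blast
  define m where "m = m' - int K"
  have p_eq: "p z = z powi m * exp (l z)" if z: "z \<in> annulus A'" for z
  proof -
    have "z powi int K * p z = z powi m' * exp (l z)"
      using l(2) P[of z] z annulus_nonzero[OF z] by simp
    then show ?thesis using annulus_nonzero[OF z] by (simp add: m_def power_int_diff field_simps)
  qed
  obtain C where C: "\<And>j. \<nu> j \<le> C * exp ((A + e / 2) * \<bar>real_of_int j\<bar>)"
    using growth[of "e / 2"] e(1) by auto
  \<comment> \<open>Half of the margin \<open>e\<close> absorbs the excess of \<open>\<nu>\<close>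
    over \<open>exp (A * \<bar>j\<bar>)\<close>; the other half makes \<open>h\<close>
    summable.\<close>
  define h where "h = (\<lambda>j. C * exp (- (e / 2 * \<bar>real_of_int j\<bar>)))"
  have hs: "h summable_on UNIV"
    unfolding h_def using e(1) by (intro summable_on_cmult_right summable_on_exp_abs_int) auto
  have \<nu>h: "\<nu> j \<le> h j * exp (A' * \<bar>real_of_int j\<bar>)" for j
  proof -
    have "h j * exp (A' * \<bar>real_of_int j\<bar>) = C * (exp (- (e / 2 * \<bar>real_of_int j\<bar>)) * exp (A' * \<bar>real_of_int j\<bar>))"
      by (simp add: h_def)
    also have "\<dots> = C * exp ((A + e / 2) * \<bar>real_of_int j\<bar>)"
      by (simp add: exp_add[symmetric] A'_def algebra_simps)
    finally show ?thesis using C[of j] by simp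
  qed
  \<comment> \<open>A supremum bound for the larger exponential weight becomes a sum bound for
    \<open>\<nu>\<close>. The constant \<open>infsum h UNIV\<close> does not depend on the function,
    so all powers are treated at the same cost.\<close>
  have transfer: "wbd UNIV g (infsum h UNIV * M)"
    if g: "W'.wser g c" and M: "\<And>j. norm (c j) * exp (A' * \<bar>real_of_int j\<bar>) \<le> M" for g c M
  proof -
    have h0: "0 \<le> h j" for j
      using \<nu>h[of j] weight_pos[of j] by (meson exp_gt_zero less_le_trans order.strict_implies_order zero_less_mult_pos2)
    have le: "\<nu> j * norm (c j) \<le> h j * M" for j
    proof -
      have "\<nu> j * norm (c j) \<le> h j * exp (A' * \<bar>real_of_int j\<bar>) * norm (c j)"
        by (intro mult_right_mono \<nu>h) auto
      also have "\<dots> = h j * (norm (c j) * exp (A' * \<bar>real_of_int j\<bar>))" by simp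
      also have "\<dots> \<le> h j * M" by (intro mult_left_mono M h0)
      finally show ?thesis .
    qed
    have hM: "(\<lambda>j. h j * M) summable_on UNIV" by (intro summable_on_cmult_left hs)
    have cs: "(\<lambda>j. \<nu> j * norm (c j)) summable_on UNIV"
      by (rule summable_on_comparison_test[OF hM]) (use le in auto)
    have "wser g c" using cs W'.wser_has_sum[OF g] A'(2) by (auto simp: wser_def)
    moreover have "wnorm c \<le> infsum h UNIV * M"
      unfolding wnorm_def infsum_cmult_left'[symmetric] by (intro infsum_mono cs hM le)
    ultimately show ?thesis unfolding wbd_def by blast
  qed
  have l': "\<exists>B. wbd UNIV l B"
  proof -
    obtain c where c: "W'.wser l c" using l(1) unfolding W'.wbd_def by blast
    have "norm (c j) * exp (A' * \<bar>real_of_int j\<bar>) \<le> W'.wnorm c" for j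
      using finite_sum_le_infsum[OF W'.wser_summable[OF c], of "{j}"] 
      by (simp add: W'.wnorm_def mult.commute)
    from transfer[OF c this] show ?thesis by blast
  qed
  \<comment> \<open>Writing \<open>(1 / p) ^ k\<close> through \<open>exp (- k * l)\<close> only
    shows that it has a Laurent series on the larger annulus; the norm obtained that way is too big.
    The useful bound comes from Cauchy's estimate for the coefficients of this series.\<close>
  have inv: "wbd UNIV (\<lambda>z. (1 / p z) ^ k) (infsum h UNIV * (2 / \<delta>) ^ k)" for k
  proof -
    obtain B1 where B1: "W'.wbd UNIV (\<lambda>z. exp ((- of_nat k) * l z)) B1"
      using W'.wbd_exp[OF W'.wbd_cmult[OF l(1), of "- of_nat k"]] by auto
    have "W'.wbd UNIV (\<lambda>z. 1 * z powi (- m * int k)) (norm (1 :: complex) * exp (A' * \<bar>real_of_int (- m * int k)\<bar>))"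
      by (rule W'.wbd_monom) simp
    from W'.wbd_mult[OF this B1]
    obtain B2 where B2: "W'.wbd UNIV (\<lambda>z. 1 * z powi (- m * int k) * exp ((- of_nat k) * l z)) B2" by blast
    have "W'.wbd UNIV (\<lambda>z. (1 / p z) ^ k) B2"
    proof (rule W'.wbd_cong[OF B2])
      fix z assume z: "z \<in> annulus A'"
      have "(1 / p z) ^ k = (z powi (- m)) ^ k * exp (- l z) ^ k"
        by (simp add: p_eq[OF z] power_int_minus exp_minus field_simps)
      also have "exp (- l z) ^ k = exp ((- of_nat k) * l z)" by (simp add: exp_of_nat_mult[symmetric])
      also have "(z powi (- m)) ^ k = 1 * z powi (- m * int k)"
        by (simp only: power_int_mult power_int_of_nat mult_1)
      finally show "1 * z powi (- m * int k) * exp ((- of_nat k) * l z) = (1 / p z) ^ k" by simp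
    qed
    then obtain c where c: "W'.wser (\<lambda>z. (1 / p z) ^ k) c" unfolding W'.wbd_def by blast
    have "norm (c j) * exp (A' * \<bar>real_of_int j\<bar>) \<le> (2 / \<delta>) ^ k" for j
    proof -
      \<comment> \<open>The outer circle serves \<open>j \<ge> 0\<close> and the inner one
        \<open>j < 0\<close>; either way
        \<open>\<rho> powi j = exp (A' * \<bar>j\<bar>)\<close>.\<close>
      define \<rho> where "\<rho> = (if 0 \<le> j then exp A' else exp (- A'))"
      have \<rho>: "0 < \<rho>" "\<And>z. norm z = \<rho> \<Longrightarrow> z \<in> annulus A'" "norm (complex_of_real \<rho>) = \<rho>"
        using A'(1) by (auto simp: \<rho>_def annulus_def)
      have "\<rho> powi j = exp (A' * \<bar>real_of_int j\<bar>)"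
        by (cases j rule: int_cases2)
          (auto simp: \<rho>_def power_int_minus exp_of_nat_mult[symmetric] exp_minus[symmetric] mult.commute)
      moreover have "norm (c j) * \<rho> powi j \<le> (2 / \<delta>) ^ k"
      proof (rule laurent_coeff_bound[OF \<rho>(1)])
        show "(\<lambda>j. norm (c j) * \<rho> powi j) summable_on UNIV"
        proof (rule summable_on_comparison_test[OF W'.wser_summable[OF c]])
          fix j show "norm (c j) * \<rho> powi j \<le> exp (A' * \<bar>real_of_int j\<bar>) * norm (c j)"
            using mult_right_mono[OF norm_powi_le_exp[OF \<rho>(2)[OF \<rho>(3)], of j], of "norm (c j)"] \<rho>(1)
            by (simp add: norm_power_int mult.commute)
        qed (use \<rho>(1) in auto)
        show "((\<lambda>j. c j * z powi j) has_sum (1 / p z) ^ k) UNIV" if "norm z = \<rho>" for z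
          by (rule W'.wser_has_sum[OF c \<rho>(2)[OF that]])
        show "norm ((1 / p z) ^ k) \<le> (2 / \<delta>) ^ k" if "norm z = \<rho>" for z
          using p_nz(2)[OF \<rho>(2)[OF that]] by (simp add: norm_power power_mono del: norm_divide)
      qed
      ultimately show ?thesis by simp
    qed
    from transfer[OF c this] show ?thesis .
  qed
  have rb: "wbd UNIV (\<lambda>z. f z - p z) (\<delta> / 4)"
    using rser wr unfolding wbd_def by blast
  have pw: "wbd UNIV (\<lambda>z. ((f z - p z) / p z) ^ k) ((\<nu> 0 * infsum h UNIV) * (1 / 2) ^ k)" for k
  proof -
    have half: "(\<delta> / 4) * (2 / \<delta>) = 1 / 2" using \<delta>(1) by simp
    have "wbd UNIV (\<lambda>z. (f z - p z) ^ k * (1 / p z) ^ k) ((\<nu> 0 * (\<delta> / 4) ^ k) * (infsum h UNIV * (2 / \<delta>) ^ k))"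
      by (intro wbd_mult wbd_power[OF rb] inv) auto
    moreover have "(\<nu> 0 * (\<delta> / 4) ^ k) * (infsum h UNIV * (2 / \<delta>) ^ k) = (\<nu> 0 * infsum h UNIV) * (1 / 2) ^ k"
      unfolding half[symmetric] power_mult_distrib by (simp only: mult_ac)
    moreover have "(f z - p z) ^ k * (1 / p z) ^ k = ((f z - p z) / p z) ^ k" for z
      by (simp add: power_divide)
    ultimately show ?thesis by (simp only:)
  qed
  obtain D where D: "wbd UNIV (\<lambda>z. Ln (1 + (f z - p z) / p z)) D"
    using wbd_Ln(1)[OF pw] by auto
  obtain B' where "wbd UNIV l B'" using l' by blast
  note W = wbd_add[OF this D]
  have "f z = z powi m * exp (l z + Ln (1 + (f z - p z) / p z))" if z: "z \<in> annulus A" for z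
  proof -
    have z': "z \<in> annulus A'" using z A'(2) by auto
    have "1 + (f z - p z) / p z = f z / p z" using p_nz(1)[OF z'] by (simp add: field_simps)
    moreover have "f z / p z \<noteq> 0" using p_nz(1)[OF z'] nz[OF z] by simp
    ultimately have "exp (Ln (1 + (f z - p z) / p z)) = f z / p z" by simp
    then show ?thesis using p_eq[OF z'] p_nz(1)[OF z'] by (simp add: exp_add mult.assoc[symmetric])
  qed
  then show ?thesis using W by blast
qed

end

section \<open>A coupled contraction\<close>

text \<open>Gaussian elimination: the unknown \<open>i0\<close> is eliminated by means of equation
  \<open>k0\<close>, and the reduced system on \<open>J\<close> has one equation and one unknown
  fewer. It serves for the \<open>n\<close> orthogonality conditions on \<open>n + 1\<close>
  coefficients.\<close>

lemma underdetermined_system: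
  fixes M :: "'k \<Rightarrow> 'i \<Rightarrow> 'a :: field"
  assumes "finite K" "finite I" "card K < card I"
  shows "\<exists>x. (\<exists>i\<in>I. x i \<noteq> 0) \<and> (\<forall>k\<in>K. (\<Sum>i\<in>I. M k i * x i) = 0)"
  using assms
proof (induction K arbitrary: I M rule: finite_induct)
  case empty
  then have "I \<noteq> {}" by auto
  then show ?case by (intro exI[of _ "\<lambda>_. 1"]) auto
next
  case (insert k0 K)
  show ?case
  proof (cases "\<forall>i\<in>I. M k0 i = 0")
    case True
    then show ?thesis using insert.IH[of I M] insert.prems insert.hyps by auto
  next
    case False
    then obtain i0 where i0: "i0 \<in> I" "M k0 i0 \<noteq> 0" by auto
    define J where "J = I - {i0}"
    have J: "finite J" "card K < card J" "i0 \<notin> J" "I = insert i0 J"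
      using insert i0 by (auto simp: J_def)
    obtain x where x: "\<exists>i\<in>J. x i \<noteq> 0"
        "\<And>k. k \<in> K \<Longrightarrow> (\<Sum>i\<in>J. (M k i - M k i0 * M k0 i / M k0 i0) * x i) = 0"
      using insert.IH[OF J(1,2), of "\<lambda>k i. M k i - M k i0 * M k0 i / M k0 i0"] by auto
    define y where "y = x(i0 := - (\<Sum>i\<in>J. M k0 i * x i) / M k0 i0)"
    have sum: "(\<Sum>i\<in>I. M k i * y i) = (\<Sum>i\<in>J. M k i * x i) - M k i0 * (\<Sum>i\<in>J. M k0 i * x i) / M k0 i0" for k
    proof -
      have "(\<Sum>i\<in>J. M k i * y i) = (\<Sum>i\<in>J. M k i * x i)"
        using J(3) by (intro sum.cong) (auto simp: y_def)
      then show ?thesis using J by (simp add: y_def)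
    qed
    have "(\<Sum>i\<in>I. M k i * y i) = 0" if "k \<in> insert k0 K" for k
    proof (cases "k = k0")
      case True
      then show ?thesis using i0 by (simp add: sum)
    next
      case False
      then have "0 = (\<Sum>i\<in>J. (M k i - M k i0 * M k0 i / M k0 i0) * x i)" using that x(2) by auto
      also have "(\<Sum>i\<in>J. (M k i - M k i0 * M k0 i / M k0 i0) * x i) = (\<Sum>i\<in>I. M k i * y i)"
        unfolding sum sum_distrib_left sum_divide_distrib sum_subtractf[symmetric]
        using i0 by (intro sum.cong) (simp_all add: field_simps)
      finally show ?thesis by simp
    qed
    moreover have "\<exists>i\<in>I. y i \<noteq> 0" using x(1) J by (auto simp: y_def)
    ultimately show ?thesis by blast
  qed
qed

text \<open>Series starting at different \<open>n\<close> are put on the common index range from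
  \<open>N\<close>, so that a finite sum over \<open>n\<close> can be carried out inside the
  series.\<close>

lemma suminf_shift:
  fixes u :: "nat \<Rightarrow> real"
  assumes "N \<le> n" "summable (\<lambda>i. u (n + i))"
  shows "summable (\<lambda>j. if n \<le> N + j then u (N + j) else 0)"
    and "(\<Sum>i. u (n + i)) = (\<Sum>j. if n \<le> N + j then u (N + j) else 0)"
proof -
  let ?w = "\<lambda>j. if n \<le> N + j then u (N + j) else 0"
  have eq: "(\<lambda>i. ?w (i + (n - N))) = (\<lambda>i. u (n + i))" using assms(1) by (auto simp: add.commute)
  show s: "summable ?w" using assms(2) summable_iff_shift[of ?w "n - N"] unfolding eq by simp
  have "(\<Sum>i<n - N. ?w i) = 0" by (intro sum.neutral) auto
  then show "(\<Sum>i. u (n + i)) = suminf ?w" using suminf_split_initial_segment[OF s, of "n - N"] unfolding eq by simp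
qed

text \<open>The system is contractive for the norm \<open>sup\<^sub>l \<Sum>\<^sub>n v (n + l) \<gamma> n l\<close>, which couples the
  different values of \<open>n\<close>: after the substitution \<open>m = n + i\<close> the sum over \<open>n\<close> can be carried
  out first.\<close>
lemma coupled_contraction:
  fixes k h v :: "nat \<Rightarrow> real" and \<gamma> :: "nat \<Rightarrow> nat \<Rightarrow> real"
  assumes nonneg: "\<And>m. 0 \<le> k m" "\<And>m. 0 \<le> h m" "\<And>m. 1 \<le> v m" "\<And>n l. 0 \<le> \<gamma> n l" "0 \<le> X"
    and v: "\<And>i l. v l \<le> v (l + i) * v i"
    and sk: "summable (\<lambda>m. v m * k m)" and sh: "summable (\<lambda>m. v m * h m)"
    and tk: "(\<Sum>j. v (N + j) * k (N + j)) \<le> 1 / 2" and th: "(\<Sum>j. v (N + j) * h (N + j)) \<le> 1 / 2"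
    and I: "finite I" "I \<subseteq> {N..}"
    and bdd: "\<And>n. n \<in> I \<Longrightarrow> \<exists>C. \<forall>l. v (n + l) * \<gamma> n l \<le> C"
    and rec: "\<And>n l. n \<in> I \<Longrightarrow> \<gamma> n l \<le> X * k (n + l) + (\<Sum>i. k (n + l + i) * (\<Sum>l'. h (n + i + l') * \<gamma> n l'))"
  shows "(\<Sum>n\<in>I. v (n + l) * \<gamma> n l) \<le> X"
proof -
  define K where "K = (\<lambda>m. v m * k m)"
  define H where "H = (\<lambda>m. v m * h m)"
  define G where "G = (\<lambda>n l. v (n + l) * \<gamma> n l)"
  define S where "S = (\<lambda>l. \<Sum>n\<in>I. G n l)"
  have v0: "0 \<le> v m" for m using nonneg(3)[of m] by linarith
  have KH0: "0 \<le> K m" "0 \<le> H m" "0 \<le> G n l" for m n l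
    using nonneg v0 by (auto simp: K_def H_def G_def)
  have S0: "0 \<le> S l" for l unfolding S_def by (intro sum_nonneg KH0)
  have sK: "summable (\<lambda>j. K (j + m))" and sH: "summable (\<lambda>j. H (j + m))" for m
    using sk sh by (auto simp: K_def H_def summable_iff_shift[of "\<lambda>m. v m * k m"] summable_iff_shift[of "\<lambda>m. v m * h m"])
  have tail: "(\<Sum>j. u (j + m)) \<le> 1 / 2"
    if u: "summable u" "\<And>j. 0 \<le> u j" "(\<Sum>j. u (N + j)) \<le> 1 / 2" and "N \<le> m" for u :: "nat \<Rightarrow> real" and m
  proof -
    have s: "summable (\<lambda>j. u (j + N))" using u(1) by (simp add: summable_iff_shift)
    have "(\<Sum>j. u (j + N)) = (\<Sum>j. u (j + (m - N) + N)) + (\<Sum>j<m - N. u (j + N))"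
      by (rule suminf_split_initial_segment[OF s])
    moreover have "0 \<le> (\<Sum>j<m - N. u (j + N))" by (intro sum_nonneg u)
    ultimately show ?thesis using u(3) \<open>N \<le> m\<close> by (simp add: add.commute)
  qed
  have tK: "(\<Sum>j. K (j + m)) \<le> 1 / 2" and tH: "(\<Sum>j. H (j + m)) \<le> 1 / 2" if "N \<le> m" for m
    using tail[OF sk _ tk that] tail[OF sh _ th that] KH0 by (auto simp: K_def H_def)
  \<comment> \<open>The a priori bounds, whatever their size, make the supremum \<open>B\<close>
    below finite; otherwise the final inequality \<open>B \<le> X / 2 + B / 4\<close> could not be
    solved for \<open>B\<close>.\<close>
  have "\<forall>n\<in>I. \<exists>C. \<forall>l. G n l \<le> C" using bdd by (simp add: G_def)
  then obtain c where c: "\<And>n l. n \<in> I \<Longrightarrow> G n l \<le> c n" by metis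
  have bddS: "bdd_above (range S)"
    by (rule bdd_aboveI[of _ "sum c I"]) (auto simp: S_def intro!: sum_mono c)
  define B where "B = (SUP l. S l)"
  have SB: "S l \<le> B" for l unfolding B_def by (rule cSUP_upper[OF _ bddS]) simp
  have B0: "0 \<le> B" using S0[of 0] SB[of 0] by linarith
  have GB: "G n l \<le> B" if "n \<in> I" for n l
    using SB[of l] member_le_sum[of n I "\<lambda>n. G n l"] that I KH0 by (auto simp: S_def)
  \<comment> \<open>\<open>U n m\<close> is the inner sum at \<open>m = n + i\<close>. For fixed
    \<open>m\<close> the kernel \<open>H (m + l')\<close> does not depend on \<open>n\<close>, so
    summing over \<open>n\<close> meets only \<open>S l' \<le> B\<close>.\<close>
  define U where "U = (\<lambda>n m. \<Sum>l'. H (m + l') * G n l')"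
  have HG: "summable (\<lambda>l'. H (m + l') * G n l')" if "n \<in> I" for n m
  proof (rule summable_comparison_test)
    show "summable (\<lambda>l'. H (l' + m) * B)" by (intro summable_mult2 sH)
    show "\<exists>N. \<forall>l'\<ge>N. norm (H (m + l') * G n l') \<le> H (l' + m) * B"
      using KH0 GB[OF that] by (auto simp: add.commute abs_mult intro!: mult_left_mono)
  qed
  have U0: "0 \<le> U n m" if "n \<in> I" for n m unfolding U_def by (intro suminf_nonneg HG that) (simp add: KH0)
  have Usum: "(\<Sum>n\<in>I. U n m) \<le> B / 2" if "N \<le> m" for m
  proof -
    have "(\<Sum>n\<in>I. U n m) = (\<Sum>l'. \<Sum>n\<in>I. H (m + l') * G n l')"
      unfolding U_def using HG by (intro suminf_sum[symmetric])
    also have "\<dots> = (\<Sum>l'. H (m + l') * S l')" by (simp add: S_def sum_distrib_left)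
    also have "\<dots> \<le> (\<Sum>l'. H (l' + m) * B)"
    proof (rule suminf_le)
      show "summable (\<lambda>l'. H (m + l') * S l')"
        unfolding S_def sum_distrib_left by (intro summable_sum HG)
    qed (auto simp: add.commute intro!: mult_left_mono SB KH0 summable_mult2 sH)
    also have "\<dots> = (\<Sum>l'. H (l' + m)) * B" by (rule suminf_mult2[OF sH, symmetric])
    also have "\<dots> \<le> 1 / 2 * B" by (intro mult_right_mono tH that B0)
    finally show ?thesis by simp
  qed
  have sU: "summable (\<lambda>i. K (n + i + l) * U n (n + i))" if n: "n \<in> I" for n l
  proof (rule summable_comparison_test)
    show "summable (\<lambda>i. K (i + (n + l)) * (B / 2))" by (intro summable_mult2 sK)
    have UB: "U n (n + i) \<le> B / 2" for i
      using Usum[of "n + i"] member_le_sum[of n I "\<lambda>n'. U n' (n + i)"] n I U0 by fastforce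
    have "K (n + i + l) * U n (n + i) \<le> K (i + (n + l)) * (B / 2)" for i
      using mult_left_mono[OF UB[of i] KH0(1)[of "n + i + l"]] by (simp add: add_ac)
    then show "\<exists>N. \<forall>i\<ge>N. norm (K (n + i + l) * U n (n + i)) \<le> K (i + (n + l)) * (B / 2)"
      using KH0 U0[OF n] by (auto simp: abs_mult)
  qed
  have Gle: "G n l \<le> X * K (n + l) + (\<Sum>i. K (n + i + l) * U n (n + i))" if n: "n \<in> I" for n l
  proof -
    \<comment> \<open>The weight is distributed in two stages:
      \<open>v (n + l) \<le> v (n + l + i) * v i\<close> serves the outer kernel, and the leftover
      \<open>v i \<le> v (n + i + l') * v (n + l')\<close> serves the inner kernel and
      \<open>\<gamma>\<close>.\<close>
    have inner: "v (n + l) * (k (n + l + i) * (\<Sum>l'. h (n + i + l') * \<gamma> n l')) \<le> K (n + i + l) * U n (n + i)" 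
      and sinner: "summable (\<lambda>l'. h (n + i + l') * \<gamma> n l')" for i
    proof -
      have le: "v i * (h (n + i + l') * \<gamma> n l') \<le> H (n + i + l') * G n l'" for l'
      proof -
        have "v i \<le> v (n + i + l') * v (n + l')" using v[of i "n + l'"] by (simp add: add_ac)
        then have "v i * (h (n + i + l') * \<gamma> n l') \<le> (v (n + i + l') * v (n + l')) * (h (n + i + l') * \<gamma> n l')"
          by (intro mult_right_mono) (simp_all add: nonneg)
        then show ?thesis by (simp add: H_def G_def mult_ac)
      qed
      show s: "summable (\<lambda>l'. h (n + i + l') * \<gamma> n l')"
      proof (rule summable_comparison_test[OF _ HG[OF n, of "n + i"]])
        have "h (n + i + l') * \<gamma> n l' \<le> v i * (h (n + i + l') * \<gamma> n l')" for l'
          using mult_right_mono[OF nonneg(3)[of i], of "h (n + i + l') * \<gamma> n l'"] nonneg by simp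
        then have "h (n + i + l') * \<gamma> n l' \<le> H (n + i + l') * G n l'" for l'
          using le[of l'] by (meson order_trans)
        then show "\<exists>N. \<forall>l'\<ge>N. norm (h (n + i + l') * \<gamma> n l') \<le> H (n + i + l') * G n l'"
          using nonneg by (auto simp: abs_mult)
      qed
      have "v i * (\<Sum>l'. h (n + i + l') * \<gamma> n l') \<le> U n (n + i)"
        unfolding U_def suminf_mult[OF s, symmetric] by (intro suminf_le le HG n summable_mult s)
      then have "K (n + i + l) * (v i * (\<Sum>l'. h (n + i + l') * \<gamma> n l')) \<le> K (n + i + l) * U n (n + i)"
        by (intro mult_left_mono KH0)
      moreover have "v (n + l) * (k (n + l + i) * (\<Sum>l'. h (n + i + l') * \<gamma> n l'))
          \<le> (v (n + l + i) * v i) * (k (n + l + i) * (\<Sum>l'. h (n + i + l') * \<gamma> n l'))"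
        by (intro mult_right_mono v mult_nonneg_nonneg nonneg suminf_nonneg s)
      ultimately show "v (n + l) * (k (n + l + i) * (\<Sum>l'. h (n + i + l') * \<gamma> n l')) \<le> K (n + i + l) * U n (n + i)"
        by (simp add: K_def mult_ac add_ac)
    qed
    have so: "summable (\<lambda>i. k (n + l + i) * (\<Sum>l'. h (n + i + l') * \<gamma> n l'))"
    proof (rule summable_comparison_test[OF _ sU[OF n, of l]])
      have "0 \<le> k (n + l + i) * (\<Sum>l'. h (n + i + l') * \<gamma> n l')" for i
        by (intro mult_nonneg_nonneg nonneg suminf_nonneg sinner)
      moreover from this have "k (n + l + i) * (\<Sum>l'. h (n + i + l') * \<gamma> n l') \<le> K (n + i + l) * U n (n + i)" for i
        using mult_right_mono[OF nonneg(3)[of "n + l"], of "k (n + l + i) * (\<Sum>l'. h (n + i + l') * \<gamma> n l')"] inner[of i]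
        by simp
      ultimately show "\<exists>N. \<forall>i\<ge>N. norm (k (n + l + i) * (\<Sum>l'. h (n + i + l') * \<gamma> n l')) \<le> K (n + i + l) * U n (n + i)"
        by auto
    qed
    have "G n l \<le> v (n + l) * (X * k (n + l) + (\<Sum>i. k (n + l + i) * (\<Sum>l'. h (n + i + l') * \<gamma> n l')))"
      unfolding G_def by (intro mult_left_mono rec n v0)
    also have "\<dots> = X * K (n + l) + (\<Sum>i. v (n + l) * (k (n + l + i) * (\<Sum>l'. h (n + i + l') * \<gamma> n l')))"
      by (simp add: distrib_left K_def suminf_mult[OF so])
    also have "\<dots> \<le> X * K (n + l) + (\<Sum>i. K (n + i + l) * U n (n + i))"
      by (intro add_left_mono suminf_le inner sU n summable_mult so)
    finally show ?thesis .
  qed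
  have "S l \<le> X / 2 + B / 4" for l
  proof -
    define w where "w = (\<lambda>n j. if n \<le> N + j then K (N + j + l) * U n (N + j) else 0)"
    have w: "summable (w n)" "(\<Sum>i. K (n + i + l) * U n (n + i)) = suminf (w n)" if "n \<in> I" for n
      using suminf_shift[of N n "\<lambda>m. K (m + l) * U n m"] sU[OF that, of l] that I by (auto simp: w_def)
    have "(\<Sum>n\<in>I. \<Sum>i. K (n + i + l) * U n (n + i)) = (\<Sum>n\<in>I. suminf (w n))"
      by (intro sum.cong w refl)
    also have "\<dots> = (\<Sum>j. \<Sum>n\<in>I. w n j)" using w by (intro suminf_sum[symmetric])
    also have "\<dots> \<le> (\<Sum>j. K (j + (N + l)) * (B / 2))"
    proof (rule suminf_le)
      fix j
      have "(\<Sum>n\<in>I. w n j) \<le> (\<Sum>n\<in>I. K (N + j + l) * U n (N + j))"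
        by (intro sum_mono) (auto simp: w_def intro!: mult_nonneg_nonneg KH0 U0)
      also have "\<dots> \<le> K (N + j + l) * (B / 2)"
        unfolding sum_distrib_left[symmetric] by (intro mult_left_mono Usum KH0) auto
      finally show "(\<Sum>n\<in>I. w n j) \<le> K (j + (N + l)) * (B / 2)" by (simp add: add_ac)
    qed (auto intro!: summable_sum w summable_mult2 sK)
    also have "\<dots> = (\<Sum>j. K (j + (N + l))) * (B / 2)" by (rule suminf_mult2[OF sK, symmetric])
    also have "\<dots> \<le> 1 / 2 * (B / 2)" using B0 by (intro mult_right_mono tK) auto
    finally have 1: "(\<Sum>n\<in>I. \<Sum>i. K (n + i + l) * U n (n + i)) \<le> B / 4" by simp
    have "(\<Sum>n\<in>I. K (n + l)) = (\<Sum>j\<in>(\<lambda>n. n - N) ` I. K (j + (N + l)))"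
      using I by (subst sum.reindex) (auto intro!: inj_on_diff_nat sum.cong arg_cong[of _ _ K])
    also have "\<dots> \<le> (\<Sum>j. K (j + (N + l)))"
      using I by (intro sum_le_suminf sK KH0) auto
    also have "\<dots> \<le> 1 / 2" by (intro tK) auto
    finally have 2: "X * (\<Sum>n\<in>I. K (n + l)) \<le> X * (1 / 2)" using nonneg(5) by (rule mult_left_mono)
    have "S l \<le> (\<Sum>n\<in>I. X * K (n + l) + (\<Sum>i. K (n + i + l) * U n (n + i)))"
      unfolding S_def by (intro sum_mono Gle)
    then show ?thesis using 1 2 by (simp add: sum.distrib sum_distrib_left)
  qed
  then have "B \<le> X / 2 + B / 4" unfolding B_def by (intro cSUP_least) auto
  then have "B \<le> X" using nonneg(5) by linarith
  then show ?thesis using SB[of l] by (simp add: S_def G_def)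
qed

section \<open>Sums over one-sided frequency sets\<close>

lemma infsum_single_term:
  fixes f :: "'b \<Rightarrow> 'a :: {topological_comm_monoid_add, t2_space}"
  assumes "\<And>j. j \<noteq> i \<Longrightarrow> f j = 0"
  shows "infsum f UNIV = f i"
  by (rule infsumI, rule has_sum_finite_neutralI[of "{i}"]) (use assms in auto)

lemma summable_reindex_nat:
  fixes u :: "'b \<Rightarrow> real" and s :: "nat \<Rightarrow> 'b"
  assumes u: "u summable_on UNIV" and s: "inj s"
  shows "(\<lambda>i. u (s i)) sums infsum u (range s)"
proof -
  have r: "u summable_on range s" using u summable_on_subset_banach by blast
  have "((\<lambda>i. u (s i)) has_sum infsum u (range s)) UNIV"
    using has_sum_reindex[OF s, of u] has_sum_infsum[OF r] by (simp add: o_def)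
  then show ?thesis by (rule has_sum_imp_sums)
qed

text \<open>For convolutions over the integers with one factor supported on a half-line, which
  \<open>s\<close> parametrizes by the naturals.\<close>

lemma norm_infsum_le_suminf:
  fixes u :: "'b \<Rightarrow> complex" and s :: "nat \<Rightarrow> 'b"
  assumes u: "(\<lambda>j. norm (u j)) summable_on UNIV" and s: "inj s" "\<And>j. j \<notin> range s \<Longrightarrow> u j = 0"
  shows "summable (\<lambda>i. norm (u (s i)))" "norm (infsum u UNIV) \<le> (\<Sum>i. norm (u (s i)))"
proof -
  note sm = summable_reindex_nat[OF u s(1)]
  then show "summable (\<lambda>i. norm (u (s i)))" by (rule sums_summable)
  have "norm (infsum u UNIV) \<le> infsum (\<lambda>j. norm (u j)) UNIV" by (rule norm_infsum_bound[OF u])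
  also have "\<dots> = infsum (\<lambda>j. norm (u j)) (range s)" by (rule infsum_cong_neutral) (use s in auto)
  also have "\<dots> = (\<Sum>i. norm (u (s i)))" using sm by (simp add: sums_iff)
  finally show "norm (infsum u UNIV) \<le> (\<Sum>i. norm (u (s i)))" .
qed

section \<open>Wiener--Hopf factorization and orthogonality\<close>

context wiener_weight
begin

text \<open>In a norm built from absolute values of coefficients, deleting frequencies never
  increases the norm. The supremum norm lacks this property, and the splitting of the logarithm
  rests on it.\<close>

lemma wser_restrict:
  assumes "wser f a"
  shows "wser (\<lambda>z. \<Sum>\<^sub>\<infinity>j. (if j \<in> S then a j else 0) * z powi j) (\<lambda>j. if j \<in> S then a j else 0)"
    and "wnorm (\<lambda>j. if j \<in> S then a j else 0) \<le> wnorm a"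
proof -
  have s: "(\<lambda>j. \<nu> j * norm (if j \<in> S then a j else 0)) summable_on UNIV"
    by (rule summable_on_comparison_test[OF wser_summable[OF assms]]) auto
  show "wnorm (\<lambda>j. if j \<in> S then a j else 0) \<le> wnorm a"
    unfolding wnorm_def by (intro infsum_mono s wser_summable[OF assms]) auto
  have "(\<lambda>j. (if j \<in> S then a j else 0) * z powi j) summable_on UNIV" if "z \<in> annulus A" for z
  proof -
    have "(\<lambda>j. a j * z powi j) summable_on S"
      using wser_has_sum[OF assms that] summable_on_subset_banach has_sum_imp_summable by blast
    then show ?thesis
      by (subst (asm) summable_on_cong_neutral[where T = UNIV and g = "\<lambda>j. (if j \<in> S then a j else 0) * z powi j"]) auto
  qed
  then show "wser (\<lambda>z. \<Sum>\<^sub>\<infinity>j. (if j \<in> S then a j else 0) * z powi j) (\<lambda>j. if j \<in> S then a j else 0)"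
    using s by (auto simp: wser_def)
qed

lemma wser_split:
  assumes f: "wser f a"
  obtains f1 f2 where "wser f1 (\<lambda>j. if j \<in> S then a j else 0)" "wser f2 (\<lambda>j. if j \<in> -S then a j else 0)"
    "\<And>z. z \<in> annulus A \<Longrightarrow> f z = f1 z + f2 z"
    "wbd S f1 (wnorm a)" "wbd (-S) f2 (wnorm a)"
proof -
  note r1 = wser_restrict[OF f, of S] and r2 = wser_restrict[OF f, of "-S"]
  show ?thesis
  proof (rule that[OF r1(1) r2(1)])
    have "(\<lambda>j. (if j \<in> S then a j else 0) + (if j \<in> -S then a j else 0)) = a" by auto
    then have "wser (\<lambda>z. (\<Sum>\<^sub>\<infinity>j. (if j \<in> S then a j else 0) * z powi j) + (\<Sum>\<^sub>\<infinity>j. (if j \<in> -S then a j else 0) * z powi j)) a"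
      using wser_add[OF r1(1) r2(1)] by simp
    from has_sum_unique[OF wser_has_sum[OF f] wser_has_sum[OF this]]
    show "f z = (\<Sum>\<^sub>\<infinity>j. (if j \<in> S then a j else 0) * z powi j) + (\<Sum>\<^sub>\<infinity>j. (if j \<in> -S then a j else 0) * z powi j)"
      if "z \<in> annulus A" for z using that by blast
  qed (use r1 r2 in \<open>unfold wbd_def, force+\<close>)
qed

lemma wser_abs_summable:
  assumes "wser f a" and s: "inj s"
  shows "summable (\<lambda>i. norm (a (s i)))"
proof -
  have "(\<lambda>j. norm (a j)) summable_on UNIV"
  proof (rule summable_on_comparison_test[OF wser_summable[OF assms(1)]])
    show "norm (a j) \<le> \<nu> j * norm (a j)" for j
      using mult_right_mono[OF weight_ge_1[of j], of "norm (a j)"] by simp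
  qed auto
  from sums_summable[OF summable_reindex_nat[OF this s]] show ?thesis .
qed

lemma wser_poly:
  "wser (poly P) (\<lambda>j. if 0 \<le> j then coeff P (nat j) else 0)"
proof -
  let ?J = "int ` {..degree P}"
  have z: "(if 0 \<le> j then coeff P (nat j) else 0) = 0" if "j \<notin> ?J" for j
  proof (rule ccontr)
    assume "\<not> ?thesis"
    then have "0 \<le> j" "nat j \<le> degree P" by (auto intro: le_degree split: if_splits)
    then have "j \<in> ?J" by (intro image_eqI[of _ _ "nat j"]) auto
    then show False using that by simp
  qed
  have "((\<lambda>j. \<nu> j * norm (if 0 \<le> j then coeff P (nat j) else 0)) has_sum
      (\<Sum>j\<in>?J. \<nu> j * norm (if 0 \<le> j then coeff P (nat j) else 0))) UNIV"
    by (rule has_sum_finite_neutralI[of ?J]) (use z in auto)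
  moreover have "((\<lambda>j. (if 0 \<le> j then coeff P (nat j) else 0) * x powi j) has_sum poly P x) UNIV" for x
  proof (rule has_sum_finite_neutralI[of ?J])
    show "poly P x = (\<Sum>j\<in>?J. (if 0 \<le> j then coeff P (nat j) else 0) * x powi j)"
      by (subst sum.reindex) (auto simp: poly_altdef)
  qed (use z in auto)
  ultimately show ?thesis by (auto simp: wser_def dest: has_sum_imp_summable)
qed

end

text \<open>Suffixes \<open>p\<close> and \<open>m\<close> stand for nonnegative and nonpositive
  frequencies; \<open>up\<close> and \<open>um\<close> invert \<open>wp\<close> and
  \<open>wm\<close>. They are recorded as series of their own because their one-sided supports are
  used as much as those of the factors.\<close>

locale wiener_hopf = wiener_weight +
  fixes w wp wm up um :: "complex \<Rightarrow> complex" and a cp cm dp dm :: "int \<Rightarrow> complex"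
  assumes w: "wser w a"
    and wp: "wser wp cp" "\<And>j. j < 0 \<Longrightarrow> cp j = 0"
    and wm: "wser wm cm" "\<And>j. j > 0 \<Longrightarrow> cm j = 0"
    and up: "wser up dp" "\<And>j. j < 0 \<Longrightarrow> dp j = 0"
    and um: "wser um dm" "\<And>j. j > 0 \<Longrightarrow> dm j = 0"
    and factor: "\<And>z. z \<in> annulus A \<Longrightarrow> w z = wp z * wm z"
    and inv_p: "\<And>z. z \<in> annulus A \<Longrightarrow> wp z * up z = 1"
    and inv_m: "\<And>z. z \<in> annulus A \<Longrightarrow> wm z * um z = 1"
begin

text \<open>\<open>kc\<close> and \<open>hc\<close> are the Laurent coefficients of
  \<open>wp / wm\<close> and \<open>wm / wp\<close>. Their tails, towards minus and plus infinity
  respectively, are the kernels of the system.\<close>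

definition kc :: "int \<Rightarrow> complex" where "kc j = (\<Sum>\<^sub>\<infinity>i. cp i * dm (j - i))"
definition hc :: "int \<Rightarrow> complex" where "hc j = (\<Sum>\<^sub>\<infinity>i. cm i * dp (j - i))"

lemma kc: "wser (\<lambda>z. wp z * um z) kc" and hc: "wser (\<lambda>z. wm z * up z) hc"
  using wser_mult(1)[OF wp(1) um(1)] wser_mult(1)[OF wm(1) up(1)] by (simp_all add: kc_def[abs_def] hc_def[abs_def])

text \<open>Both \<open>wp\<close> and \<open>up\<close> have only nonnegative frequencies, so the
  constant coefficient of \<open>wp * up = 1\<close> is the single product
  \<open>cp 0 * dp 0\<close>.\<close>

lemma cp_0: "cp 0 \<noteq> 0"
proof -
  have "wser (\<lambda>z. wp z * up z) (\<lambda>j. if j = 0 then 1 else 0)"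
    by (rule wser_cong[OF wser_monom[of 1 0]]) (simp add: inv_p)
  from fun_cong[OF wser_unique[OF this wser_mult(1)[OF wp(1) up(1)]], of 0]
  have "1 = (\<Sum>\<^sub>\<infinity>i. cp i * dp (0 - i))" by simp
  also have "\<dots> = cp 0 * dp (0 - 0)"
    by (rule infsum_single_term) (use wp(2) up(2) in \<open>auto simp: neq_iff\<close>)
  finally show ?thesis by auto
qed

text \<open>A Toeplitz system with symbol \<open>w\<close>. The leading coefficient is left free, so
  that the solutions form a linear space containing both the monic ones
  (\<open>coeff P n = 1\<close>) and those to be excluded (\<open>coeff P n = 0\<close>).\<close>

definition quasi_orthogonal :: "nat \<Rightarrow> complex poly \<Rightarrow> bool" where
  "quasi_orthogonal n P \<longleftrightarrow> degree P \<le> n \<and> (\<forall>k<n. (\<Sum>i\<le>n. a (int k - int i) * coeff P i) = 0)"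

text \<open>With \<open>P w = f + g\<close>, where \<open>f\<close> has frequencies \<open>\<ge> n\<close> and \<open>g\<close> has frequencies \<open>< 0\<close>, and
  \<open>F = f / wp\<close>, \<open>G = g / wm\<close>, one has \<open>P wm = F + (wm / wp) G\<close> and \<open>P wp = (wp / wm) F + G\<close>. Here
  \<open>\<gamma> l\<close> is the coefficient of index \<open>- l\<close> of \<open>(wp / wm) F\<close>.\<close>
lemma quasi_orthogonal_system:
  assumes P: "quasi_orthogonal n P"
  obtains \<gamma> :: "nat \<Rightarrow> complex" where
    "\<exists>C. \<forall>l. \<nu> (int (n + l)) * norm (\<gamma> l) \<le> C"
    "\<And>l. norm (\<gamma> l) \<le> norm (coeff P n * cm 0) * norm (kc (- int (n + l))) +
       (\<Sum>i. norm (kc (- int (n + l + i))) * (\<Sum>l'. norm (hc (int (n + i + l'))) * norm (\<gamma> l')))"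
    "coeff P 0 * cp 0 = \<gamma> 0"
    "coeff P n = 0 \<Longrightarrow> (\<And>l. \<gamma> l = 0) \<Longrightarrow> P = 0"
proof -
  define p where "p = (\<lambda>j::int. if 0 \<le> j then coeff P (nat j) else 0)"
  have degP: "degree P \<le> n" using P by (simp add: quasi_orthogonal_def)
  have p: "wser (poly P) p" unfolding p_def by (rule wser_poly)
  have p_int: "p (int i) = coeff P i" and p_neg: "j < 0 \<Longrightarrow> p j = 0" for i j by (auto simp: p_def)
  have p_large: "p j = 0" if "int n < j" for j
    using that degP by (auto simp: p_def intro!: coeff_eq_0)
  \<comment> \<open>\<open>R\<close> holds the coefficients of \<open>P w\<close>. Orthogonality
    says that they vanish from 0 to \<open>n - 1\<close>; this is the gap between \<open>f\<close>
    and \<open>g\<close>.\<close>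
  define R where "R = (\<lambda>j. \<Sum>\<^sub>\<infinity>i. p i * a (j - i))"
  have R: "wser (\<lambda>z. poly P z * w z) R" unfolding R_def by (rule wser_mult(1)[OF p w])
  have R0: "R (int k) = 0" if "k < n" for k
  proof -
    have "((\<lambda>i. p i * a (int k - i)) has_sum (\<Sum>i\<in>int ` {..n}. p i * a (int k - i))) UNIV"
    proof (rule has_sum_finite_neutralI)
      fix i assume i: "i \<in> UNIV - int ` {..n}"
      have "i < 0 \<or> int n < i"
      proof (rule ccontr)
        assume "\<not> ?thesis"
        then have "i = int (nat i)" "nat i \<le> n" by auto
        then show False using i by blast
      qed
      then show "p i * a (int k - i) = 0" using p_neg p_large by auto
    qed auto
    then have "R (int k) = (\<Sum>i\<in>int ` {..n}. p i * a (int k - i))" by (simp add: R_def has_sum_iff)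
    also have "\<dots> = (\<Sum>i\<le>n. a (int k - int i) * coeff P i)"
      by (subst sum.reindex) (auto simp: p_int mult.commute)
    finally show ?thesis using P that by (simp add: quasi_orthogonal_def)
  qed
  define T where "T = {j. int n \<le> j}"
  obtain f g where f: "wser f (\<lambda>j. if j \<in> T then R j else 0)" and g: "wser g (\<lambda>j. if j \<in> -T then R j else 0)"
    and fg: "\<And>z. z \<in> annulus A \<Longrightarrow> poly P z * w z = f z + g z"
    by (rule wser_split[OF R, of T]) blast
  have f_supp: "(if j \<in> T then R j else 0) = 0" if "j < int n" for j using that by (auto simp: T_def)
  have g_supp: "(if j \<in> -T then R j else 0) = 0" if "0 \<le> j" for j
    using that R0[of "nat j"] by (auto simp: T_def)
  define F where "F = (\<lambda>j. \<Sum>\<^sub>\<infinity>i. (if i \<in> T then R i else 0) * dp (j - i))"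
  define G where "G = (\<lambda>j. \<Sum>\<^sub>\<infinity>i. (if i \<in> -T then R i else 0) * dm (j - i))"
  have F: "wser (\<lambda>z. f z * up z) F" unfolding F_def by (rule wser_mult(1)[OF f up(1)])
  have G: "wser (\<lambda>z. g z * um z) G" unfolding G_def by (rule wser_mult(1)[OF g um(1)])
  have F_supp: "F j = 0" if "j < int n" for j
    unfolding F_def
  proof (rule infsum_0)
    fix i show "(if i \<in> T then R i else 0) * dp (j - i) = 0"
      using f_supp[of i] up(2)[of "j - i"] that by (cases "i < int n") auto
  qed
  have G_supp: "G j = 0" if "0 \<le> j" for j
    unfolding G_def
  proof (rule infsum_0)
    fix i show "(if i \<in> -T then R i else 0) * dm (j - i) = 0"
      using g_supp[of i] um(2)[of "j - i"] that by (cases "0 \<le> i") auto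
  qed
  define Fk where "Fk = (\<lambda>j. \<Sum>\<^sub>\<infinity>i. F i * kc (j - i))"
  define Gh where "Gh = (\<lambda>j. \<Sum>\<^sub>\<infinity>i. G i * hc (j - i))"
  have Fk: "wser (\<lambda>z. f z * up z * (wp z * um z)) Fk" unfolding Fk_def by (rule wser_mult(1)[OF F kc])
  have Gh: "wser (\<lambda>z. g z * um z * (wm z * up z)) Gh" unfolding Gh_def by (rule wser_mult(1)[OF G hc])
  define Y where "Y = (\<lambda>j. \<Sum>\<^sub>\<infinity>i. p i * cp (j - i))"
  define X where "X = (\<lambda>j. \<Sum>\<^sub>\<infinity>i. p i * cm (j - i))"
  have Y: "wser (\<lambda>z. poly P z * wp z) Y" unfolding Y_def by (rule wser_mult(1)[OF p wp(1)])
  have X: "wser (\<lambda>z. poly P z * wm z) X" unfolding X_def by (rule wser_mult(1)[OF p wm(1)])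
  have "wser (\<lambda>z. poly P z * wp z) (\<lambda>j. Fk j + G j)"
  proof (rule wser_cong[OF wser_add[OF Fk G]])
    fix z assume z: "z \<in> annulus A"
    have "f z * up z * (wp z * um z) + g z * um z = (f z * (wp z * up z) + g z) * um z"
      by (simp add: algebra_simps)
    also have "\<dots> = (poly P z * w z) * um z" using fg[OF z] inv_p[OF z] by simp
    also have "\<dots> = poly P z * wp z * (wm z * um z)" using factor[OF z] by simp
    finally show "f z * up z * (wp z * um z) + g z * um z = poly P z * wp z" using inv_m[OF z] by simp
  qed
  from wser_unique[OF Y this] have Yeq: "Y j = Fk j + G j" for j by simp
  have "wser (\<lambda>z. poly P z * wm z) (\<lambda>j. F j + Gh j)"
  proof (rule wser_cong[OF wser_add[OF F Gh]])
    fix z assume z: "z \<in> annulus A"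
    have "f z * up z + g z * um z * (wm z * up z) = (f z + g z * (wm z * um z)) * up z"
      by (simp add: algebra_simps)
    also have "\<dots> = (poly P z * w z) * up z" using fg[OF z] inv_m[OF z] by simp
    also have "\<dots> = poly P z * wm z * (wp z * up z)" using factor[OF z] by simp
    finally show "f z * up z + g z * um z * (wm z * up z) = poly P z * wm z" using inv_p[OF z] by simp
  qed
  from wser_unique[OF X this] have Xeq: "X j = F j + Gh j" for j by simp
  \<comment> \<open>\<open>P wp\<close> has no negative frequencies, so \<open>G\<close> cancels
    \<open>Fk\<close> there; dually \<open>P wm\<close> has none above \<open>n\<close>, so
    \<open>F\<close> cancels \<open>Gh\<close> there. At the edges, frequency 0 of
    \<open>P wp\<close> and frequency \<open>n\<close> of \<open>P wm\<close> display the constant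
    and the top coefficient of \<open>P\<close>.\<close>
  have Y_neg: "Y j = 0" if "j < 0" for j
    unfolding Y_def
  proof (rule infsum_0)
    fix i show "p i * cp (j - i) = 0" using p_neg[of i] wp(2)[of "j - i"] that by (cases "i < 0") auto
  qed
  have Y_0: "Y 0 = coeff P 0 * cp 0"
  proof -
    have "Y 0 = p 0 * cp (0 - 0)"
      unfolding Y_def by (rule infsum_single_term) (use p_neg wp(2) in \<open>auto simp: neq_iff\<close>)
    then show ?thesis using p_int[of 0] by simp
  qed
  have X_large: "X j = 0" if "int n < j" for j
    unfolding X_def
  proof (rule infsum_0)
    fix i show "p i * cm (j - i) = 0" using p_large[of i] wm(2)[of "j - i"] that by (cases "int n < i") auto
  qed
  have X_n: "X (int n) = coeff P n * cm 0"
  proof -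
    have "X (int n) = p (int n) * cm (int n - int n)"
      unfolding X_def by (rule infsum_single_term) (use p_large wm(2) in \<open>auto simp: neq_iff\<close>)
    then show ?thesis using p_int by simp
  qed
  define \<gamma> where "\<gamma> = (\<lambda>l. Fk (- int l))"
  \<comment> \<open>Equality holds for \<open>l > 0\<close>. At \<open>l = 0\<close> the left side
    vanishes while \<open>\<gamma> 0\<close> is \<open>coeff P 0 * cp 0\<close>; admitting this
    index makes the value of \<open>P\<close> at the origin part of the system.\<close>
  have G_le: "norm (G (- int l)) \<le> norm (\<gamma> l)" for l
    using Yeq[of "- int l"] Y_neg[of "- int l"] G_supp[of 0]
    by (cases "l = 0") (auto simp: \<gamma>_def add_eq_0_iff)
  have Fk_sum: "norm (\<gamma> l) \<le> (\<Sum>i. norm (F (int n + int i)) * norm (kc (- int (n + l + i))))"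
    and Fk_summable: "summable (\<lambda>i. norm (F (int n + int i)) * norm (kc (- int (n + l + i))))" for l
  proof -
    let ?u = "\<lambda>j. F j * kc (- int l - j)" and ?s = "\<lambda>i. int n + int i"
    have u: "(\<lambda>j. norm (?u j)) summable_on UNIV" by (rule wser_mult(3)[OF F kc])
    have s: "inj ?s" "\<And>j. j \<notin> range ?s \<Longrightarrow> ?u j = 0"
    proof -
      show "inj ?s" by (auto simp: inj_on_def)
      show "?u j = 0" if "j \<notin> range ?s" for j
      proof -
        have "j < int n"
        proof (rule ccontr)
          assume "\<not> j < int n"
          then have "j = ?s (nat (j - int n))" by simp
          then show False using that by blast
        qed
        then show ?thesis using F_supp by simp
      qed
    qed
    have eq: "norm (?u (?s i)) = norm (F (int n + int i)) * norm (kc (- int (n + l + i)))" for i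
    proof -
      have "- int l - ?s i = - int (n + l + i)" by simp
      then show ?thesis by (simp only: norm_mult)
    qed
    show "norm (\<gamma> l) \<le> (\<Sum>i. norm (F (int n + int i)) * norm (kc (- int (n + l + i))))"
      "summable (\<lambda>i. norm (F (int n + int i)) * norm (kc (- int (n + l + i))))"
      using norm_infsum_le_suminf[OF u s] unfolding eq by (simp_all add: \<gamma>_def Fk_def)
  qed
  have bdd: "\<exists>C. \<forall>l. \<nu> (int l) * norm (\<gamma> l) \<le> C"
  proof (intro exI allI)
    fix l
    show "\<nu> (int l) * norm (\<gamma> l) \<le> wnorm Fk"
      using finite_sum_le_infsum[OF wser_summable[OF Fk], of "{- int l}"] weight_minus[of "int l"]
      by (simp add: wnorm_def \<gamma>_def)
  qed
  then obtain C where C: "\<And>l. \<nu> (int l) * norm (\<gamma> l) \<le> C" by blast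
  have \<gamma>C: "norm (\<gamma> l) \<le> C" for l
    using mult_right_mono[OF weight_ge_1[of "int l"], of "norm (\<gamma> l)"] C[of l] by simp
  define E where "E = (\<lambda>i. \<Sum>l'. norm (hc (int (n + i + l'))) * norm (\<gamma> l'))"
  have Gh_sum: "norm (Gh (int n + int i)) \<le> E i"
    and E_summable: "summable (\<lambda>l'. norm (hc (int (n + i + l'))) * norm (\<gamma> l'))"
    and E_bdd: "E i \<le> (\<Sum>l. norm (hc (int l))) * C" for i
  proof -
    let ?u = "\<lambda>j. G j * hc (int n + int i - j)" and ?s = "\<lambda>l::nat. - int l"
    have u: "(\<lambda>j. norm (?u j)) summable_on UNIV" by (rule wser_mult(3)[OF G hc])
    have s: "inj ?s" "\<And>j. j \<notin> range ?s \<Longrightarrow> ?u j = 0"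
    proof -
      show "inj ?s" by (auto simp: inj_on_def)
      show "?u j = 0" if "j \<notin> range ?s" for j
      proof -
        have "0 \<le> j"
        proof (rule ccontr)
          assume "\<not> 0 \<le> j"
          then have "j = ?s (nat (- j))" by simp
          then show False using that by blast
        qed
        then show ?thesis using G_supp by simp
      qed
    qed
    have eq: "norm (?u (?s l)) = norm (hc (int (n + i + l))) * norm (G (- int l))" for l
    proof -
      have "int n + int i - ?s l = int (n + i + l)" by simp
      then show ?thesis by (simp only: norm_mult mult.commute)
    qed
    have hs: "summable (\<lambda>l. norm (hc (int (n + i + l))))"
      by (rule wser_abs_summable[OF hc]) (auto simp: inj_on_def)
    show sE: "summable (\<lambda>l'. norm (hc (int (n + i + l'))) * norm (\<gamma> l'))"
    proof (rule summable_comparison_test)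
      show "summable (\<lambda>l. norm (hc (int (n + i + l))) * C)" by (intro summable_mult2 hs)
      show "\<exists>N. \<forall>l\<ge>N. norm (norm (hc (int (n + i + l))) * norm (\<gamma> l)) \<le> norm (hc (int (n + i + l))) * C"
        by (auto intro!: mult_left_mono \<gamma>C)
    qed
    have "E i \<le> (\<Sum>l. norm (hc (int (n + i + l))) * C)"
      unfolding E_def
    proof (rule suminf_le[OF _ sE])
      show "norm (hc (int (n + i + l))) * norm (\<gamma> l) \<le> norm (hc (int (n + i + l))) * C" for l
        by (intro mult_left_mono \<gamma>C) auto
    qed (intro summable_mult2 hs)
    also have "\<dots> = (\<Sum>l. norm (hc (int (l + (n + i))))) * C"
      using suminf_mult2[OF hs, of C] by (simp add: add_ac)
    also have "(\<Sum>l. norm (hc (int (l + (n + i))))) \<le> (\<Sum>l. norm (hc (int l)))"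
    proof -
      have "summable (\<lambda>l. norm (hc (int l)))"
        by (rule wser_abs_summable[OF hc]) (auto simp: inj_on_def)
      from suminf_split_initial_segment[OF this, of "n + i"] show ?thesis
        using sum_nonneg[of "{..<n + i}" "\<lambda>l. norm (hc (int l))"] by simp
    qed
    finally show "E i \<le> (\<Sum>l. norm (hc (int l))) * C"
      using order_trans[OF norm_ge_zero \<gamma>C[of 0]] by (simp add: mult_right_mono)
    have sG: "summable (\<lambda>l. norm (hc (int (n + i + l))) * norm (G (- int l)))"
      using norm_infsum_le_suminf(1)[OF u s] unfolding eq .
    have "norm (Gh (int n + int i)) \<le> (\<Sum>l. norm (hc (int (n + i + l))) * norm (G (- int l)))"
      using norm_infsum_le_suminf(2)[OF u s] unfolding eq by (simp add: Gh_def)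
    also have "\<dots> \<le> E i"
      unfolding E_def by (intro suminf_le mult_left_mono G_le sE sG) auto
    finally show "norm (Gh (int n + int i)) \<le> E i" .
  qed
  have E0: "0 \<le> E i" for i unfolding E_def by (intro suminf_nonneg E_summable) auto
  have F_le: "norm (F (int n + int i)) \<le> (if i = 0 then norm (coeff P n * cm 0) else 0) + E i" for i
  proof -
    have "F (int n + int i) = X (int n + int i) - Gh (int n + int i)" using Xeq by simp
    then have "norm (F (int n + int i)) \<le> norm (X (int n + int i)) + norm (Gh (int n + int i))"
      by (simp add: norm_triangle_ineq4)
    moreover have "norm (X (int n + int i)) = (if i = 0 then norm (coeff P n * cm 0) else 0)"
      using X_n X_large[of "int n + int i"] by auto
    ultimately show ?thesis using Gh_sum[of i] by linarith
  qed
  show ?thesis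
  proof (rule that[of \<gamma>])
    \<comment> \<open>Passing from the weight \<open>\<nu> l\<close> to \<open>\<nu> (n + l)\<close>
      costs the factor \<open>\<nu> n\<close>, harmless here because the bound may depend on
      \<open>n\<close>.\<close>
    show "\<exists>C. \<forall>l. \<nu> (int (n + l)) * norm (\<gamma> l) \<le> C"
    proof (intro exI allI)
      fix l
      have "\<nu> (int (n + l)) * norm (\<gamma> l) \<le> (\<nu> (int n) * \<nu> (int l)) * norm (\<gamma> l)"
        using weight_add[of "int n" "int l"] by (intro mult_right_mono) auto
      also have "\<dots> \<le> \<nu> (int n) * C" using mult_left_mono[OF C[of l], of "\<nu> (int n)"] by (simp add: mult.assoc)
      finally show "\<nu> (int (n + l)) * norm (\<gamma> l) \<le> \<nu> (int n) * C" .
    qed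
    show "coeff P 0 * cp 0 = \<gamma> 0" using Yeq[of 0] G_supp[of 0] Y_0 by (simp add: \<gamma>_def)
    \<comment> \<open>With \<open>\<gamma>\<close> also \<open>F\<close>, \<open>G\<close> and then
      \<open>P wp\<close> vanish, and a polynomial vanishing on the whole circle is zero.\<close>
    show "P = 0" if "coeff P n = 0" and \<gamma>0: "\<And>l. \<gamma> l = 0"
    proof -
      have "E i = 0" for i by (simp add: E_def \<gamma>0)
      then have "F (int n + int i) = 0" for i using F_le[of i] \<open>coeff P n = 0\<close> by (auto split: if_splits)
      then have "F j = 0" for j using F_supp[of j] \<open>\<And>i. F (int n + int i) = 0\<close>[of "nat (j - int n)"] by (cases "j < int n") auto
      then have Fk0: "Fk j = 0" for j by (simp add: Fk_def)
      have "G j = 0" for j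
        using G_le[of "nat (- j)"] G_supp[of j] \<gamma>0 by (cases "0 \<le> j") auto
      then have "Y = (\<lambda>j. 0)" using Yeq Fk0 by auto
      then have Y0: "wser (\<lambda>z. poly P z * wp z) (\<lambda>j. 0)" using Y by simp
      have "poly P z = 0" if z: "norm z = 1" for z
      proof -
        have zA: "z \<in> annulus A" by (rule one_in_annulus[OF z])
        have "poly P z * wp z = 0" using wser_has_sum[OF Y0 zA] by (simp add: has_sum_iff)
        then show ?thesis using inv_p[OF zA] by auto
      qed
      then have "sphere 0 1 \<subseteq> {z. poly P z = 0}" by auto
      moreover have "infinite (sphere 0 1 :: complex set)"
        by (rule uncountable_infinite, rule connected_uncountable[of _ 1 "-1"])
          (auto simp: connected_sphere_eq)
      ultimately have "infinite {z. poly P z = 0}" using finite_subset by blast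
      then show "P = 0" using poly_roots_finite by blast
    qed
    fix l
    have sEk: "summable (\<lambda>i. norm (kc (- int (n + l + i))) * E i)" 
    proof (rule summable_comparison_test)
      have "summable (\<lambda>i. norm (kc (- int (n + l + i))))"
        by (rule wser_abs_summable[OF kc]) (auto simp: inj_on_def)
      then show "summable (\<lambda>i. norm (kc (- int (n + l + i))) * ((\<Sum>l. norm (hc (int l))) * C))"
        by (rule summable_mult2)
      show "\<exists>N. \<forall>i\<ge>N. norm (norm (kc (- int (n + l + i))) * E i) \<le> norm (kc (- int (n + l + i))) * ((\<Sum>l. norm (hc (int l))) * C)"
        using E0 by (auto simp: abs_mult intro!: mult_left_mono E_bdd)
    qed
    have "norm (\<gamma> l) \<le> (\<Sum>i. norm (F (int n + int i)) * norm (kc (- int (n + l + i))))" by (rule Fk_sum)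
    also have "\<dots> \<le> (\<Sum>i. (if i = 0 then norm (coeff P n * cm 0) * norm (kc (- int (n + l))) else 0) + norm (kc (- int (n + l + i))) * E i)"
    proof (rule suminf_le[OF _ Fk_summable])
      fix i show "norm (F (int n + int i)) * norm (kc (- int (n + l + i))) \<le> (if i = 0 then norm (coeff P n * cm 0) * norm (kc (- int (n + l))) else 0) + norm (kc (- int (n + l + i))) * E i"
        using mult_right_mono[OF F_le[of i], of "norm (kc (- int (n + l + i)))"] by (cases "i = 0") (auto simp: algebra_simps)
    qed (intro summable_add sEk sums_summable[OF sums_single])
    also have "\<dots> = norm (coeff P n * cm 0) * norm (kc (- int (n + l))) + (\<Sum>i. norm (kc (- int (n + l + i))) * E i)"
      using sums_add[OF sums_single[of 0 "\<lambda>i. norm (coeff P n * cm 0) * norm (kc (- int (n + l)))"] summable_sums[OF sEk]]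
      by (simp add: sums_iff)
    finally show "norm (\<gamma> l) \<le> norm (coeff P n * cm 0) * norm (kc (- int (n + l))) +
       (\<Sum>i. norm (kc (- int (n + l + i))) * (\<Sum>l'. norm (hc (int (n + i + l'))) * norm (\<gamma> l')))"
      by (simp add: E_def)
  qed
qed

end

section \<open>Summation over all degrees; existence and uniqueness\<close>

lemma suminf_tail_small:
  fixes u :: "nat \<Rightarrow> real"
  assumes "summable u" "0 < e"
  shows "\<exists>N. \<forall>n\<ge>N. (\<Sum>j. u (n + j)) \<le> e"
  using suminf_exist_split[OF assms(2,1)] by (force simp: add.commute)

context wiener_hopf
begin

lemma weighted_summable:
  assumes "wser f b" and s: "inj s" "\<And>i. \<bar>s i\<bar> = int i"
  shows "summable (\<lambda>i. \<nu> (int i) * norm (b (s i)))"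
proof -
  have "\<nu> (s i) = \<nu> (int i)" for i using s(2)[of i] weight_minus[of "s i"] by (auto simp: abs_if split: if_splits)
  then show ?thesis using sums_summable[OF summable_reindex_nat[OF wser_summable[OF assms(1)] s(1)]] by simp
qed

text \<open>One estimate is applied twice: a singleton \<open>I\<close> with \<open>X = 0\<close>
  excludes nonzero solutions with vanishing top coefficient, and \<open>X = norm (cm 0)\<close> with
  arbitrary finite \<open>I\<close> bounds the weighted sum, the value at the origin being
  \<open>\<gamma> n 0 / cp 0\<close>.\<close>

lemma quasi_orthogonal_sum_bound:
  obtains N where "\<And>n P. N \<le> n \<Longrightarrow> quasi_orthogonal n P \<Longrightarrow> coeff P n = 0 \<Longrightarrow> P = 0"
    and "\<And>I P. finite I \<Longrightarrow> I \<subseteq> {N..} \<Longrightarrow> \<forall>n\<in>I. quasi_orthogonal n (P n) \<and> coeff (P n) n = 1 \<Longrightarrow>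
      (\<Sum>n\<in>I. \<nu> (int n) * norm (coeff (P n) 0)) \<le> norm (cm 0) / norm (cp 0)"
proof -
  define v where "v = (\<lambda>m. \<nu> (int m))"
  define k where "k = (\<lambda>m. norm (kc (- int m)))"
  define h where "h = (\<lambda>m. norm (hc (int m)))"
  have sk: "summable (\<lambda>m. v m * k m)" and sh: "summable (\<lambda>m. v m * h m)"
    unfolding v_def k_def h_def
    by (intro weighted_summable[OF kc] weighted_summable[OF hc]; auto simp: inj_on_def)+
  obtain N1 where N1: "\<And>n. N1 \<le> n \<Longrightarrow> (\<Sum>j. v (n + j) * k (n + j)) \<le> 1 / 2"
    using suminf_tail_small[OF sk, of "1 / 2"] by auto
  obtain N2 where N2: "\<And>n. N2 \<le> n \<Longrightarrow> (\<Sum>j. v (n + j) * h (n + j)) \<le> 1 / 2"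
    using suminf_tail_small[OF sh, of "1 / 2"] by auto
  define N where "N = max N1 N2"
  have bound: "(\<Sum>n\<in>I. v (n + l) * norm (\<gamma> n l)) \<le> X"
    if "finite I" "I \<subseteq> {N..}" "0 \<le> X"
      and "\<And>n. n \<in> I \<Longrightarrow> \<exists>C. \<forall>l. \<nu> (int (n + l)) * norm (\<gamma> n l) \<le> C"
      and "\<And>n l. n \<in> I \<Longrightarrow> norm (\<gamma> n l) \<le> X * norm (kc (- int (n + l))) +
       (\<Sum>i. norm (kc (- int (n + l + i))) * (\<Sum>l'. norm (hc (int (n + i + l'))) * norm (\<gamma> n l')))"
    for I X l and \<gamma> :: "nat \<Rightarrow> nat \<Rightarrow> complex"
  proof (rule coupled_contraction[where k = k and h = h and N = N])
    \<comment> \<open>The symmetry of the weight enters here, through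
      \<open>l = (l + i) + (- i)\<close>.\<close>
    show "v l \<le> v (l + i) * v i" for i l
      using weight_add[of "int (l + i)" "- int i"] weight_minus[of "int i"] by (simp add: v_def)
    show "\<exists>C. \<forall>l. v (n + l) * norm (\<gamma> n l) \<le> C" if "n \<in> I" for n
      using \<open>\<And>n. n \<in> I \<Longrightarrow> \<exists>C. _ n C\<close>[OF that] by (simp add: v_def)
    show "norm (\<gamma> n l) \<le> X * k (n + l) + (\<Sum>i. k (n + l + i) * (\<Sum>l'. h (n + i + l') * norm (\<gamma> n l')))"
      if "n \<in> I" for n l
      unfolding k_def h_def by (rule \<open>\<And>n l. n \<in> I \<Longrightarrow> norm (\<gamma> n l) \<le> _ n l\<close>[OF that])
  qed (use that N1 N2 sk sh weight_ge_1 in \<open>auto simp: N_def k_def h_def v_def\<close>)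
  show ?thesis
  proof (rule that[of N])
    fix n P assume n: "N \<le> n" and P: "quasi_orthogonal n P" "coeff P n = 0"
    obtain \<gamma> :: "nat \<Rightarrow> complex" where \<gamma>: "\<exists>C. \<forall>l. \<nu> (int (n + l)) * norm (\<gamma> l) \<le> C"
      "\<And>l. norm (\<gamma> l) \<le> norm (coeff P n * cm 0) * norm (kc (- int (n + l))) +
         (\<Sum>i. norm (kc (- int (n + l + i))) * (\<Sum>l'. norm (hc (int (n + i + l'))) * norm (\<gamma> l')))"
      "coeff P n = 0 \<Longrightarrow> (\<And>l. \<gamma> l = 0) \<Longrightarrow> P = 0"
      by (rule quasi_orthogonal_system[OF P(1)]) blast
    have "\<gamma> l = 0" for l
    proof -
      have "(\<Sum>n\<in>{n}. v (n + l) * norm (\<gamma> l)) \<le> 0"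
        by (rule bound[of "{n}" 0 "\<lambda>_. \<gamma>"]) (use n \<gamma>(1) \<gamma>(2)[unfolded P(2)] in auto)
      moreover have "0 < v (n + l)" by (simp add: v_def)
      ultimately show ?thesis by (simp add: mult_le_0_iff)
    qed
    then show "P = 0" using \<gamma>(3) P(2) by blast
  next
    fix I P assume I: "finite I" "I \<subseteq> {N..}" and P: "\<forall>n\<in>I. quasi_orthogonal n (P n) \<and> coeff (P n) n = 1"
    \<comment> \<open>One \<open>\<gamma>\<close> per \<open>n\<close> has to be fixed before
      summing over \<open>n\<close>; \<open>good\<close> bundles all properties that the choice must
      retain.\<close>
    define good where "good n g \<longleftrightarrow> (\<exists>C. \<forall>l. \<nu> (int (n + l)) * norm (g l) \<le> C) \<and>
      (\<forall>l. norm (g l) \<le> norm (cm 0) * norm (kc (- int (n + l))) +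
         (\<Sum>i. norm (kc (- int (n + l + i))) * (\<Sum>l'. norm (hc (int (n + i + l'))) * norm (g l')))) \<and>
      coeff (P n) 0 * cp 0 = g 0" for n and g :: "nat \<Rightarrow> complex"
    have ex: "\<exists>g. good n g" if n: "n \<in> I" for n
    proof -
      have P1: "quasi_orthogonal n (P n)" "coeff (P n) n = 1" using P n by auto
      show ?thesis
        unfolding good_def by (rule quasi_orthogonal_system[OF P1(1)], unfold P1(2) mult_1) blast
    qed
    define \<gamma> where "\<gamma> n = (SOME g. good n g)" for n
    have "good n (\<gamma> n)" if "n \<in> I" for n
      unfolding \<gamma>_def by (rule someI_ex[OF ex[OF that]])
    then have \<gamma>: "\<And>n. n \<in> I \<Longrightarrow> \<exists>C. \<forall>l. \<nu> (int (n + l)) * norm (\<gamma> n l) \<le> C"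
      "\<And>n l. n \<in> I \<Longrightarrow> norm (\<gamma> n l) \<le> norm (cm 0) * norm (kc (- int (n + l))) +
         (\<Sum>i. norm (kc (- int (n + l + i))) * (\<Sum>l'. norm (hc (int (n + i + l'))) * norm (\<gamma> n l')))"
      "\<And>n. n \<in> I \<Longrightarrow> coeff (P n) 0 * cp 0 = \<gamma> n 0"
      unfolding good_def by blast+
    have "(\<Sum>n\<in>I. \<nu> (int n) * norm (coeff (P n) 0)) * norm (cp 0) = (\<Sum>n\<in>I. v (n + 0) * norm (\<gamma> n 0))"
      unfolding sum_distrib_right v_def using \<gamma>(3) by (intro sum.cong) (auto simp: norm_mult[symmetric] mult.assoc)
    also have "\<dots> \<le> norm (cm 0)"
      by (rule bound[OF I _ \<gamma>(1,2)]) auto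
    finally show "(\<Sum>n\<in>I. \<nu> (int n) * norm (coeff (P n) 0)) \<le> norm (cm 0) / norm (cp 0)"
      using cp_0 by (simp add: field_simps)
  qed
qed

text \<open>One unknown more than equations yields a nonzero solution. By the assumption its top
  coefficient is nonzero, so it can be normalized, and the difference of two monic solutions falls
  under the assumption again.\<close>

lemma monic_quasi_orthogonal_exists:
  assumes inj: "\<And>P. quasi_orthogonal n P \<Longrightarrow> coeff P n = 0 \<Longrightarrow> P = 0"
  shows "\<exists>!P. quasi_orthogonal n P \<and> coeff P n = 1"
proof -
  obtain x where x: "\<exists>i\<in>{..n}. x i \<noteq> 0" "\<And>k. k < n \<Longrightarrow> (\<Sum>i\<le>n. a (int k - int i) * x i) = 0"
    using underdetermined_system[of "{..<n}" "{..n}" "\<lambda>k i. a (int k - int i)"] by auto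
  define Q where "Q = (\<Sum>i\<le>n. monom (x i) i)"
  have Q: "coeff Q i = (if i \<le> n then x i else 0)" for i
    by (auto simp: Q_def coeff_sum coeff_monom)
  have degQ: "degree Q \<le> n" by (rule degree_le) (simp add: Q)
  have qQ: "quasi_orthogonal n Q" using degQ x(2) by (simp add: quasi_orthogonal_def Q)
  have "Q \<noteq> 0" using x(1) Q by (metis atMost_iff coeff_0)
  then have xn: "coeff Q n \<noteq> 0" using inj[OF qQ] by blast
  have lin: "quasi_orthogonal n (smult c P - smult d P')" if "quasi_orthogonal n P" "quasi_orthogonal n P'" for P P' c d
  proof -
    have deg: "degree (smult c P - smult d P') \<le> n"
      using that degree_smult_le[of c P] degree_smult_le[of d P']
      by (intro degree_diff_le) (auto simp: quasi_orthogonal_def)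
    have "(\<Sum>i\<le>n. a (int k - int i) * coeff (smult c P - smult d P') i) =
      c * (\<Sum>i\<le>n. a (int k - int i) * coeff P i) - d * (\<Sum>i\<le>n. a (int k - int i) * coeff P' i)" for k
      by (simp add: sum_distrib_left sum_subtractf algebra_simps)
    then show ?thesis using that deg by (simp add: quasi_orthogonal_def)
  qed
  show ?thesis
  \<comment> \<open>The summand \<open>smult 0 Q\<close> is zero; it brings the witness into the
    form treated by \<open>lin\<close>.\<close>
  proof (rule ex1I[of _ "smult (1 / coeff Q n) Q - smult 0 Q"])
    show "quasi_orthogonal n (smult (1 / coeff Q n) Q - smult 0 Q) \<and> coeff (smult (1 / coeff Q n) Q - smult 0 Q) n = 1"
      using lin[OF qQ qQ, of "1 / coeff Q n" 0] xn by simp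
  next
    fix P assume P: "quasi_orthogonal n P \<and> coeff P n = 1"
    have "smult 1 P - smult (1 / coeff Q n) Q = 0"
      by (rule inj[OF lin]) (use P qQ xn in auto)
    then show "P = smult (1 / coeff Q n) Q - smult 0 Q" by simp
  qed
qed

end

text \<open>The link between \<open>w\<close> itself and the algebra, which sees only Fourier
  coefficients. Integrability lets the integral pass through the finite sum, and the factor
  \<open>cis \<theta> ^ i\<close> of the i-th term shifts the frequency \<open>k\<close> to
  \<open>k - i\<close>.\<close>

lemma monic_OP_iff:
  assumes w: "in_L1_circle w"
  shows "monic_OP w n P \<longleftrightarrow> degree P \<le> n \<and> coeff P n = 1 \<and>
    (\<forall>k<n. (\<Sum>i\<le>n. fourier_coeff w (int k - int i) * coeff P i) = 0)"
proof -
  have bil: "bilinear ((*) :: complex \<Rightarrow> complex \<Rightarrow> complex)"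
    using bounded_bilinear_mult by (simp add: bilinear_conv_bounded_bilinear)
  have int1: "(\<lambda>\<theta>. cis (- (of_int j * \<theta>)) * w (cis \<theta>)) integrable_on {-pi..pi}" for j :: int
  proof -
    have "(\<lambda>\<theta>. cis (- (of_int j * \<theta>)) * w (cis \<theta>)) absolutely_integrable_on {-pi..pi}"
    proof (rule absolutely_integrable_bounded_measurable_product[OF bil])
      show "(\<lambda>\<theta>. cis (- (of_int j * \<theta>))) \<in> borel_measurable (lebesgue_on {- pi..pi})"
        by (intro continuous_imp_measurable_on_sets_lebesgue continuous_intros) auto
      show "bounded ((\<lambda>\<theta>. cis (- (of_int j * \<theta>))) ` {-pi..pi})" by (auto simp: bounded_iff)
      show "(\<lambda>\<theta>. w (cis \<theta>)) absolutely_integrable_on {-pi..pi}" using w by (simp add: in_L1_circle_def)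
    qed auto
    then show ?thesis by (rule absolutely_integrable_on_def[THEN iffD1, THEN conjunct1])
  qed
  have fc: "integral {-pi..pi} (\<lambda>\<theta>. cis (- (of_int j * \<theta>)) * w (cis \<theta>)) = 2 * pi * fourier_coeff w j" for j
    by (simp add: fourier_coeff_def)
  have I: "integral {-pi..pi} (\<lambda>\<theta>. poly P (cis \<theta>) * cis (- (real k * \<theta>)) * w (cis \<theta>))
      = 2 * pi * (\<Sum>i\<le>n. fourier_coeff w (int k - int i) * coeff P i)" if deg: "degree P \<le> n" for k
  proof -
    have "poly P (cis \<theta>) * cis (- (real k * \<theta>)) * w (cis \<theta>) =
       (\<Sum>i\<le>n. coeff P i * (cis (- (of_int (int k - int i) * \<theta>)) * w (cis \<theta>)))" for \<theta>
    proof -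
      have "poly P (cis \<theta>) = (\<Sum>i\<le>n. coeff P i * cis \<theta> ^ i)"
        unfolding poly_altdef using deg by (intro sum.mono_neutral_left) (auto intro: coeff_eq_0)
      then have "poly P (cis \<theta>) * cis (- (real k * \<theta>)) = (\<Sum>i\<le>n. coeff P i * (cis \<theta> ^ i * cis (- (real k * \<theta>))))"
        by (simp add: sum_distrib_right mult.assoc)
      also have "\<dots> = (\<Sum>i\<le>n. coeff P i * cis (- (of_int (int k - int i) * \<theta>)))"
      proof (intro sum.cong refl arg_cong2[of _ _ _ _ "(*)"])
        fix i
        have "cis \<theta> ^ i * cis (- (real k * \<theta>)) = cis (real i * \<theta> + - (real k * \<theta>))"
          by (simp only: Complex.DeMoivre cis_mult)
        then show "cis \<theta> ^ i * cis (- (real k * \<theta>)) = cis (- (of_int (int k - int i) * \<theta>))"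
          by (simp add: left_diff_distrib)
      qed
      finally show ?thesis by (simp add: sum_distrib_right mult.assoc)
    qed
    then have "integral {-pi..pi} (\<lambda>\<theta>. poly P (cis \<theta>) * cis (- (real k * \<theta>)) * w (cis \<theta>))
      = (\<Sum>i\<le>n. coeff P i * (2 * pi * fourier_coeff w (int k - int i)))"
      by (simp only: integral_sum[OF _ integrable_on_mult_right[OF int1]] finite_atMost integral_mult_right fc)
    also have "\<dots> = 2 * pi * (\<Sum>i\<le>n. fourier_coeff w (int k - int i) * coeff P i)"
      by (simp add: sum_distrib_left mult_ac)
    finally show ?thesis .
  qed
  have "degree P = n \<and> lead_coeff P = 1 \<longleftrightarrow> degree P \<le> n \<and> coeff P n = 1"
    using le_degree[of P n] by force
  then show ?thesis unfolding monic_OP_def using I by auto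
qed

text \<open>The sets \<open>{0..}\<close> and \<open>{..0}\<close> are closed under addition and
  contain 0, so exponentials stay in them; the multipliers \<open>t = 1\<close> and
  \<open>t = -1\<close> give each factor and its inverse.\<close>

lemma wiener_hopf_of_log:
  assumes "wiener_weight \<nu> A" and w: "wiener_weight.wser \<nu> A w a" and L: "wiener_weight.wbd \<nu> A UNIV L B"
    and wL: "\<And>z. z \<in> annulus A \<Longrightarrow> w z = exp (L z)"
  obtains wp wm up um cp cm dp dm where "wiener_hopf \<nu> A w wp wm up um a cp cm dp dm"
proof -
  interpret wiener_weight \<nu> A by fact
  obtain b where b: "wser L b" using L by (auto simp: wbd_def)
  obtain Lp Lm where split: "\<And>z. z \<in> annulus A \<Longrightarrow> L z = Lp z + Lm z"
    "wbd {0..} Lp (wnorm b)" "wbd (- {0..}) Lm (wnorm b)"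
    by (rule wser_split[OF b, of "{0..}"]) blast
  \<comment> \<open>\<open>Lm\<close> has only negative frequencies, but its exponential contains
    the constant 1, so 0 joins the support.\<close>
  have Lm: "wbd {..0} Lm (wnorm b)" by (rule wbd_mono[OF split(3)]) auto
  have ex: "\<exists>c. wser (\<lambda>z. exp (t * f z)) c \<and> (\<forall>j. j \<notin> S \<longrightarrow> c j = 0)"
    if "wbd S f (wnorm b)" "0 \<in> S" "\<And>i j. i \<in> S \<Longrightarrow> j \<in> S \<Longrightarrow> i + j \<in> S" for t S f
    using wbd_exp[OF wbd_cmult[OF that(1), of t] that(2,3)] unfolding wbd_def by blast
  obtain cp where cp: "wser (\<lambda>z. exp (1 * Lp z)) cp" "\<forall>j. j \<notin> {0..} \<longrightarrow> cp j = 0"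
    using ex[OF split(2), of 1] by auto
  obtain dp where dp: "wser (\<lambda>z. exp (-1 * Lp z)) dp" "\<forall>j. j \<notin> {0..} \<longrightarrow> dp j = 0"
    using ex[OF split(2), of "-1"] by auto
  obtain cm where cm: "wser (\<lambda>z. exp (1 * Lm z)) cm" "\<forall>j. j \<notin> {..0} \<longrightarrow> cm j = 0"
    using ex[OF Lm, of 1] by auto
  obtain dm where dm: "wser (\<lambda>z. exp (-1 * Lm z)) dm" "\<forall>j. j \<notin> {..0} \<longrightarrow> dm j = 0"
    using ex[OF Lm, of "-1"] by auto
  have "wiener_hopf \<nu> A w (\<lambda>z. exp (1 * Lp z)) (\<lambda>z. exp (1 * Lm z)) (\<lambda>z. exp (-1 * Lp z)) (\<lambda>z. exp (-1 * Lm z)) a cp cm dp dm"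
  proof unfold_locales
    show "w z = exp (1 * Lp z) * exp (1 * Lm z)" if "z \<in> annulus A" for z
      using wL[OF that] split(1)[OF that] by (simp add: exp_add)
    have inv: "exp (1 * x) * exp (-1 * x) = 1" for x :: complex by (simp add: exp_minus)
    show "exp (1 * Lp z) * exp (-1 * Lp z) = 1" "exp (1 * Lm z) * exp (-1 * Lm z) = 1" for z by (rule inv)+
  qed (use w cp dp cm dm in auto)
  then show ?thesis by (rule that)
qed

theorem theorem2:
  fixes \<nu> :: "int \<Rightarrow> real" and w :: "complex \<Rightarrow> complex"
  assumes "beurling_weight \<nu>"
    and "w \<in> beurling_class \<nu>"
    and "\<forall>z\<in>beurling_annulus \<nu>. fourier_ext w z \<noteq> 0"
    and "wind0 w = 0"
  shows "\<exists>n0::nat. (\<forall>n\<ge>n0. \<exists>!p. monic_OP w n p) \<and>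
           (\<lambda>n. \<nu> (int n) * norm (poly (THE p. monic_OP w n p) 0)) summable_on {n0..}"
proof -
  define A where "A = beurling_A \<nu>"
  note A = beurling_A_bounds[OF assms(1), folded A_def]
  have W: "wiener_weight \<nu> A" by unfold_locales (use assms(1) A in auto)
  interpret wiener_weight \<nu> A by (rule W)
  have annulus: "beurling_annulus \<nu> = annulus A"
    by (simp add: beurling_annulus_def annulus_def A_def)
  have L1: "in_L1_circle w" and sm: "(\<lambda>j. \<nu> j * norm (fourier_coeff w j)) summable_on UNIV"
    using assms(2) by (auto simp: beurling_class_def)
  \<comment> \<open>From here on \<open>fourier_ext w\<close>, the continuous representative, takes
    the place of \<open>w\<close>, which may differ from it on a null set of the circle.\<close>
  have ser: "wser (fourier_ext w) (fourier_coeff w)"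
    unfolding wser_def
  proof (intro conjI ballI sm)
    fix z assume z: "z \<in> annulus A"
    have "(\<lambda>j. norm (fourier_coeff w j * z powi j)) summable_on UNIV"
    proof (rule summable_on_comparison_test[OF sm])
      show "norm (fourier_coeff w j * z powi j) \<le> \<nu> j * norm (fourier_coeff w j)" for j
        using mult_right_mono[OF norm_powi_le[OF z, of j], of "norm (fourier_coeff w j)"]
        by (simp add: norm_mult mult.commute)
    qed auto
    then show "((\<lambda>j. fourier_coeff w j * z powi j) has_sum fourier_ext w z) UNIV"
      unfolding fourier_ext_def by (rule has_sum_infsum[OF abs_summable_summable])
  qed
  obtain m L B where L: "wbd UNIV L B" "\<forall>z\<in>annulus A. fourier_ext w z = z powi m * exp (L z)"
    using wiener_levy_log[OF A(3) ser] assms(3) unfolding annulus by blast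
  have "m = 0"
  proof (rule winding_zero_imp_power_zero[of "fourier_ext w" m L])
    show "fourier_ext w z = z powi m * exp (L z)" if "norm z = 1" for z
      using L(2) one_in_annulus[OF that] by blast
    obtain b where "wser L b" using L(1) unfolding wbd_def by blast
    from wser_continuous_on[OF this] show "continuous_on (sphere 0 1) L"
      by (rule continuous_on_subset) (auto intro: one_in_annulus)
    show "winding_number (\<lambda>t. fourier_ext w (cis (2 * pi * t))) 0 = 0"
      using assms(4) by (simp add: wind0_def)
  qed
  then have wL: "\<And>z. z \<in> annulus A \<Longrightarrow> fourier_ext w z = exp (L z)" using L(2) by simp
  obtain wp wm up um cp cm dp dm where
    "wiener_hopf \<nu> A (fourier_ext w) wp wm up um (fourier_coeff w) cp cm dp dm"
    using wiener_hopf_of_log[OF W ser L(1) wL] by blast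
  then interpret wiener_hopf \<nu> A "fourier_ext w" wp wm up um "fourier_coeff w" cp cm dp dm .
  have OP: "monic_OP w n P \<longleftrightarrow> quasi_orthogonal n P \<and> coeff P n = 1" for n P
    unfolding monic_OP_iff[OF L1] quasi_orthogonal_def by blast
  obtain N where N: "\<And>n P. N \<le> n \<Longrightarrow> quasi_orthogonal n P \<Longrightarrow> coeff P n = 0 \<Longrightarrow> P = 0"
    "\<And>I P. finite I \<Longrightarrow> I \<subseteq> {N..} \<Longrightarrow> \<forall>n\<in>I. quasi_orthogonal n (P n) \<and> coeff (P n) n = 1 \<Longrightarrow>
      (\<Sum>n\<in>I. \<nu> (int n) * norm (coeff (P n) 0)) \<le> norm (cm 0) / norm (cp 0)"
    using quasi_orthogonal_sum_bound by blast
  have ex1: "\<exists>!p. monic_OP w n p" if "N \<le> n" for n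
    unfolding OP by (rule monic_quasi_orthogonal_exists[OF N(1)[OF that]])
  define \<Phi> where "\<Phi> = (\<lambda>n. THE p. monic_OP w n p)"
  have \<Phi>: "quasi_orthogonal n (\<Phi> n) \<and> coeff (\<Phi> n) n = 1" if "N \<le> n" for n
    using theI'[OF ex1[OF that]] unfolding \<Phi>_def OP .
  have "(\<lambda>n. \<nu> (int n) * norm (poly (\<Phi> n) 0)) summable_on {N..}"
  proof (rule nonneg_bdd_above_summable_on)
    show "bdd_above (sum (\<lambda>n. \<nu> (int n) * norm (poly (\<Phi> n) 0)) ` {F. F \<subseteq> {N..} \<and> finite F})"
    proof (rule bdd_aboveI)
      fix y assume "y \<in> sum (\<lambda>n. \<nu> (int n) * norm (poly (\<Phi> n) 0)) ` {F. F \<subseteq> {N..} \<and> finite F}"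
      then obtain F where F: "finite F" "F \<subseteq> {N..}" "y = (\<Sum>n\<in>F. \<nu> (int n) * norm (coeff (\<Phi> n) 0))"
        by (auto simp: poly_0_coeff_0)
      show "y \<le> norm (cm 0) / norm (cp 0)"
        unfolding F(3) by (rule N(2)[OF F(1,2)]) (use F(2) \<Phi> in auto)
    qed
  qed auto
  then show ?thesis using ex1 unfolding \<Phi>_def by blast
qed

end
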